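(* Consider a win-lose graph on two letters with finite vertex set $S$, in which every vertex has exactly one outgoing edge labeled $0$ and exactly one outgoing edge labeled $1$. Let $(D_i)_{i\in S}$ be its domains and $(f_i)_{i\in S}$ the corresponding invariant densities (as defined in the context). Then the functions $f_i$, $i \in S$, are all rational fractions if and only if the domains $D_i$, $i\in S$, are all finite unions of projective intervals up to sets of zero Lebesgue measure.
   Context: $\mathbb{R}_+=[0,\infty)$, $(\cdot|\cdot)$ is the standard scalar product on $\mathbb{R}^2$, $\lambda$ is Lebesgue measure on $\mathbb{R}^2$. Coordinates of $\mathbb{R}^2$ are indexed by $0,1$. A win-lose graph on two letters is a finite directed graph with edges labeled by $0$ or $1$, with at most one outgoing edge of each label from each vertex. When every vertex has both outgoing edges, the associated continued fraction algorithm $F:\mathbb{R}_+^2\times S\to\mathbb{R}_+^2\times S$ is defined almost everywhere by $F(x,i)=(x',k)$, where $i\xrightarrow{j}k$ is the edge whose label $j\in\{0,1\}$ satisfies $x_j\le x_l$ for $l=1-j$, and $x'$ is obtained from $x$ by replacing $x_l$ by $x_l-x_j$. Thus $x'=m_j^{-1}x$ with $m_0=\begin{pmatrix}1&0\\1&1\end{pmatrix}$, $m_1=\begin{pmatrix}1&1\\0&1\end{pmatrix}$. Denote the transposes by $\mathbf 0={}^t m_0=\begin{pmatrix}1&1\\0&1\end{pmatrix}$ and $\mathbf 1={}^t m_1=\begin{pmatrix}1&0\\1&1\end{pmatrix}$. For $i\in S$, the domain language $\mathcal D_i$ is the set of finite words $u_1\dots u_n$ over $\{\mathbf 0,\mathbf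 1\}$ such that there is a path $i_n\to i_{n-1}\to\dots\to i_1\to i_0=i$ in the graph in which the edge $i_k\to i_{k-1}$ has the label ($0$ or $1$) corresponding to $u_k$ ($1\le k\le n$). The domain of vertex $i$ is the limit set $$D_i=\bigcap_{n\in\mathbb N}\ \bigcup_{u_1\dots u_n\in\mathcal D_i}u_1\cdots u_n\mathbb{R}_+^2 ,$$ where $u_1\cdots u_n$ on the right is the matrix product. The domains satisfy $D_i=\bigcup_{j\xrightarrow{a}i}{}^t m_a D_j$ with the union Lebesgue-disjoint. The corresponding invariant density at vertex $i$ is $f_i(x)=\lambda(\{y\in D_i\mid (y|x)\le 1\})$ for $x\in(\mathbb{R}_+^* )^2$. A projective interval is a cone of the form $M\mathbb{R}_+^2$ with $M$ a $2\times 2$ matrix with non-negative real entries. "$f_i$ is a rational fraction" means that $f_i$ coincides on $(\mathbb{R}_+^* )^2$ with a rational function of $(x_0,x_1)$ with real coefficients. An empty union is allowed. *)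

theory Defs
  imports "HOL-Analysis.Analysis"
begin

text \<open>
  Letters, edge labels and coordinates of the plane all live in the two-element type \<^typ>\<open>2\<close>, whose
  elements are \<open>0\<close> and \<open>1\<close>. In this type \<open>2 = 0\<close>, so that \<^const>\<open>vector\<close>, which fills the
  positions \<open>1\<close> and \<open>2\<close> in this order, would put its first entry at coordinate \<open>1\<close>; it is not used here.
\<close>

text \<open>A triple \<open>(i, a, k)\<close> is an edge from \<open>i\<close> to \<open>k\<close> with label \<open>a\<close>.\<close>

definition win_lose_graph :: "'v set \<Rightarrow> ('v \<times> 2 \<times> 'v) set \<Rightarrow> bool" where
  "win_lose_graph S E \<longleftrightarrow>
     finite S \<and> E \<subseteq> S \<times> UNIV \<times> S \<and>
     (\<forall>i a k k'. (i, a, k) \<in> E \<longrightarrow> (i, a, k') \<in> E \<longrightarrow> k = k')"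

definition nonneg_quadrant :: "(real^2) set" where
  "nonneg_quadrant = {x. \<forall>l. 0 \<le> x $ l}"

definition pos_quadrant :: "(real^2) set" where
  "pos_quadrant = {x. \<forall>l. 0 < x $ l}"

text \<open>
  The continued fraction algorithm subtracts \<open>x $ j\<close> from the other coordinate: \<open>x = step_matrix j *v x'\<close>.
\<close>

definition step_matrix :: "2 \<Rightarrow> real^2^2" where
  "step_matrix j = (\<chi> r c. if r = c \<or> c = j then 1 else 0)"

definition letter_matrix :: "2 \<Rightarrow> real^2^2" where
  "letter_matrix j = transpose (step_matrix j)"

lemma letter_matrix_entries:
  "letter_matrix 0 $ 0 $ 0 = 1" "letter_matrix 0 $ 0 $ 1 = 1"
  "letter_matrix 0 $ 1 $ 0 = 0" "letter_matrix 0 $ 1 $ 1 = 1"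
  "letter_matrix 1 $ 0 $ 0 = 1" "letter_matrix 1 $ 0 $ 1 = 0"
  "letter_matrix 1 $ 1 $ 0 = 1" "letter_matrix 1 $ 1 $ 1 = 1"
  by (simp_all add: letter_matrix_def step_matrix_def transpose_def)

fun word_matrix :: "2 list \<Rightarrow> real^2^2" where
  "word_matrix [] = mat 1"
| "word_matrix (a # u) = letter_matrix a ** word_matrix u"

text \<open>
  A word is read against the direction of the path \<open>p n \<rightarrow> \<dots> \<rightarrow> p 1 \<rightarrow> p 0 = i\<close>:
  its first letter is the label of the last edge, the one arriving at \<open>i\<close>.
\<close>

definition domain_language :: "('v \<times> 2 \<times> 'v) set \<Rightarrow> 'v \<Rightarrow> 2 list set" where
  "domain_language E i =
     {u. \<exists>p :: nat \<Rightarrow> 'v. p 0 = i \<and> (\<forall>k < length u. (p (Suc k), u ! k, p k) \<in> E)}"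

definition wl_domain :: "('v \<times> 2 \<times> 'v) set \<Rightarrow> 'v \<Rightarrow> (real^2) set" where
  "wl_domain E i =
     (\<Inter>n. \<Union>u \<in> {u \<in> domain_language E i. length u = n}. (*v) (word_matrix u) ` nonneg_quadrant)"

text \<open>
  The set measured here is Borel, and bounded for \<open>x \<in> pos_quadrant\<close>. The density is only meant
  for such \<open>x\<close>.
\<close>

definition invariant_density :: "('v \<times> 2 \<times> 'v) set \<Rightarrow> 'v \<Rightarrow> real^2 \<Rightarrow> real" where
  "invariant_density E i x = measure lebesgue {y \<in> wl_domain E i. y \<bullet> x \<le> 1}"

definition rational_fraction :: "(real^2 \<Rightarrow> real) \<Rightarrow> bool" where
  "rational_fraction f \<longleftrightarrow>
     (\<exists>P Q. real_polynomial_function P \<and> real_polynomial_function Q \<and>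
        (\<forall>x \<in> pos_quadrant. Q x \<noteq> 0 \<and> f x = P x / Q x))"

definition projective_interval :: "(real^2) set \<Rightarrow> bool" where
  "projective_interval J \<longleftrightarrow>
     (\<exists>M :: real^2^2. (\<forall>r c. 0 \<le> M $ r $ c) \<and> J = (*v) M ` nonneg_quadrant)"

definition ae_finite_union_of_intervals :: "(real^2) set \<Rightarrow> bool" where
  "ae_finite_union_of_intervals D \<longleftrightarrow>
     (\<exists>I. finite I \<and> (\<forall>J \<in> I. projective_interval J) \<and> sym_diff D (\<Union>I) \<in> null_sets lebesgue)"

end

theory Submission
  imports Defs
begin

text \<open>
  Fubini in the coordinates \<open>y = \<sigma> (s, 1 - s)\<close> turns the density of a cone with slice \<open>K \<subseteq> [0, 1]\<close> into
  \<open>1/2 \<integral>\<^sub>K (x\<^sub>0 s + x\<^sub>1 (1 - s))\<^sup>-\<^sup>2 ds\<close>. If \<open>K\<close> is an interval, this is an explicit rational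
  function, and finite unions follow by inclusion-exclusion.

  Conversely, put \<open>x = (1 - w, 1)\<close>. The density becomes \<open>1/2 \<Sum>n. (n + 1) m\<^sub>n w\<^sup>n\<close> with \<open>m\<^sub>n\<close> the moments
  of \<open>K\<close>, so rationality is a linear recurrence on the \<open>(n + 1) m\<^sub>n\<close>. It says that
  \<open>\<integral>\<^sub>K (r B)' = 0\<close> for a fixed polynomial \<open>B \<noteq> 0\<close> and all polynomials \<open>r\<close>; by Weierstrass
  approximation the same holds for all \<open>C\<^sup>1\<close> functions \<open>r\<close>. Hence the indicator function of \<open>K\<close> has zero
  distributional derivative off the roots of \<open>B\<close>, and \<open>K\<close> is null or full between consecutive roots.
\<close>

subsection \<open>Slices of planar cones\<close>

lemma UNIV_two: "(UNIV :: 2 set) = {0, 1}"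
  using exhaust_2 by force

lemma all_two: "(\<forall>l::2. P l) \<longleftrightarrow> P 0 \<and> P 1"
  using UNIV_two by (metis (full_types) UNIV_I empty_iff insertE)

lemma sum_two: "(\<Sum>l\<in>(UNIV::2 set). f l) = f 0 + f 1"
  by (simp add: UNIV_two)

definition vec2 :: "real \<Rightarrow> real \<Rightarrow> real^2" where
  "vec2 p q = (\<chi> l. if l = 0 then p else q)"

lemma vec2_nth [simp]: "vec2 p q $ 0 = p" "vec2 p q $ 1 = q"
  by (simp_all add: vec2_def)

lemma vec2_eq_iff: "vec2 p q = y \<longleftrightarrow> p = y $ 0 \<and> q = y $ 1"
  by (auto simp: vec_eq_iff all_two)

lemma scaleR_vec2: "c *\<^sub>R vec2 p q = vec2 (c * p) (c * q)"
  by (simp add: vec_eq_iff all_two)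

lemma inner_two: "(y :: real^2) \<bullet> x = y $ 0 * x $ 0 + y $ 1 * x $ 1"
  by (simp add: inner_vec_def sum_two)

lemma nonneg_quadrant_two: "y \<in> nonneg_quadrant \<longleftrightarrow> 0 \<le> y $ 0 \<and> 0 \<le> y $ 1"
  by (simp add: nonneg_quadrant_def all_two)

lemma pos_quadrant_two: "x \<in> pos_quadrant \<longleftrightarrow> 0 < x $ 0 \<and> 0 < x $ 1"
  by (simp add: pos_quadrant_def all_two)

lemma continuous_on_vec2 [continuous_intros]:
  assumes "continuous_on A f" "continuous_on A g"
  shows "continuous_on A (\<lambda>x. vec2 (f x) (g x))"
  unfolding vec2_def
proof (rule continuous_on_vec_lambda)
  show "continuous_on A (\<lambda>x. if l = 0 then f x else g x)" for l :: 2
    using assms by (cases "l = 0") auto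
qed

lemma vec2_measurable [measurable]:
  "(\<lambda>(p, q). vec2 p q) \<in> borel \<Otimes>\<^sub>M borel \<rightarrow>\<^sub>M borel"
  unfolding borel_prod
  by (rule borel_measurable_continuous_onI) (auto simp: case_prod_unfold intro!: continuous_intros)

lemma vec2_measurable' [measurable (raw)]:
  assumes [measurable]: "f \<in> borel_measurable M" "g \<in> borel_measurable M"
  shows "(\<lambda>x. vec2 (f x) (g x)) \<in> borel_measurable M"
proof -
  have "(\<lambda>x. (f x, g x)) \<in> M \<rightarrow>\<^sub>M borel \<Otimes>\<^sub>M borel" by measurable
  from measurable_compose[OF this vec2_measurable] show ?thesis by simp
qed

text \<open>Carries Fubini for a product of two lines over to the plane. Lebesgue measure is
  determined by the volumes of boxes, and a box pulls back to a rectangle.\<close>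

lemma lborel_vec2: "(lborel :: (real^2) measure) = distr (lborel \<Otimes>\<^sub>M lborel) borel (\<lambda>(p, q). vec2 p q)"
proof (rule lborel_eqI)
  fix l u :: "real^2"
  assume le: "\<And>b. b \<in> Basis \<Longrightarrow> l \<bullet> b \<le> u \<bullet> b"
  have le': "l $ i \<le> u $ i" for i
    using le[of "axis i 1"] by (auto simp: inner_axis Basis_vec_def)
  have vim: "(\<lambda>(p, q). vec2 p q) -` box l u = {l $ 0 <..< u $ 0} \<times> {l $ 1 <..< u $ 1}"
    by (auto simp: mem_box_cart all_two)
  have "emeasure (distr (lborel \<Otimes>\<^sub>M lborel) borel (\<lambda>(p, q). vec2 p q)) (box l u)
        = emeasure (lborel \<Otimes>\<^sub>M lborel) ({l $ 0 <..< u $ 0} \<times> {l $ 1 <..< u $ 1})"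
    by (subst emeasure_distr) (auto simp: vim space_pair_measure)
  also have "\<dots> = ennreal ((u $ 0 - l $ 0) * (u $ 1 - l $ 1))"
    by (subst lborel.emeasure_pair_measure_Times) (auto simp: le' ennreal_mult)
  also have "(u $ 0 - l $ 0) * (u $ 1 - l $ 1) = (\<Prod>i\<in>UNIV. (u - l) $ i)"
    by (simp add: UNIV_two)
  \<comment> \<open>Both products are the content of the closed box from \<open>l\<close> to
    \<open>u\<close>, by coordinates and by basis vectors.\<close>
  also have "\<dots> = (\<Prod>b\<in>Basis. (u - l) \<bullet> b)"
    using content_cbox_cart[of l u] content_cbox[of l u] le le'
    by (auto simp: interval_eq_empty_cart inner_diff_left not_less)
  finally show "emeasure (distr (lborel \<Otimes>\<^sub>M lborel) borel (\<lambda>(p, q). vec2 p q)) (box l u)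
        = ennreal (\<Prod>b\<in>Basis. (u - l) \<bullet> b)" .
qed simp

text \<open>Here \<open>\<sigma>\<close> is the sum of the two coordinates and \<open>s\<close> the share of the first one: a shear followed by
  a rescaling of each line of constant \<open>\<sigma>\<close>.\<close>

lemma nn_integral_lborel_slices:
  fixes g :: "real^2 \<Rightarrow> ennreal"
  assumes [measurable]: "g \<in> borel_measurable borel"
  shows "(\<integral>\<^sup>+y. g y \<partial>lborel) =
    (\<integral>\<^sup>+s. \<integral>\<^sup>+\<sigma>. ennreal \<bar>\<sigma>\<bar> * g (\<sigma> *\<^sub>R vec2 s (1 - s)) \<partial>lborel \<partial>lborel)"
proof -
  have "(\<integral>\<^sup>+y. g y \<partial>lborel) = (\<integral>\<^sup>+p. \<integral>\<^sup>+q. g (vec2 p q) \<partial>lborel \<partial>lborel)"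
    by (subst lborel_vec2, subst nn_integral_distr)
       (simp_all add: lborel.nn_integral_fst[symmetric] case_prod_unfold)
  also have "\<dots> = (\<integral>\<^sup>+p. \<integral>\<^sup>+\<sigma>. g (vec2 p (\<sigma> - p)) \<partial>lborel \<partial>lborel)"
  proof (rule nn_integral_cong)
    show "(\<integral>\<^sup>+q. g (vec2 p q) \<partial>lborel) = (\<integral>\<^sup>+\<sigma>. g (vec2 p (\<sigma> - p)) \<partial>lborel)" for p
      by (subst nn_integral_real_affine[where t = "- p" and c = 1]) simp_all
  qed
  also have "\<dots> = (\<integral>\<^sup>+\<sigma>. \<integral>\<^sup>+p. g (vec2 p (\<sigma> - p)) \<partial>lborel \<partial>lborel)"
    by (rule lborel_pair.Fubini') simp
  also have "\<dots> = (\<integral>\<^sup>+\<sigma>. \<integral>\<^sup>+s. ennreal \<bar>\<sigma>\<bar> * g (\<sigma> *\<^sub>R vec2 s (1 - s)) \<partial>lborel \<partial>lborel)"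
  \<comment> \<open>The rescaling of the line degenerates at \<sigma> = 0, which is a single point
    and hence null.\<close>
  proof (rule nn_integral_cong_AE, rule AE_mp[OF AE_lborel_singleton[of 0]], intro AE_I2 impI)
    fix \<sigma> :: real assume "\<sigma> \<noteq> 0"
    then show "(\<integral>\<^sup>+p. g (vec2 p (\<sigma> - p)) \<partial>lborel) = (\<integral>\<^sup>+s. ennreal \<bar>\<sigma>\<bar> * g (\<sigma> *\<^sub>R vec2 s (1 - s)) \<partial>lborel)"
      by (subst nn_integral_real_affine[where c = \<sigma> and t = 0])
         (simp_all add: nn_integral_cmult scaleR_vec2 algebra_simps)
  qed
  also have "\<dots> = (\<integral>\<^sup>+s. \<integral>\<^sup>+\<sigma>. ennreal \<bar>\<sigma>\<bar> * g (\<sigma> *\<^sub>R vec2 s (1 - s)) \<partial>lborel \<partial>lborel)"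
    by (rule lborel_pair.Fubini') (simp add: scaleR_vec2)
  finally show ?thesis .
qed

text \<open>Every nonzero ray of the quadrant meets the line of coordinate sum 1 exactly once, so
  the slice is an affine chart for the directions of a cone.\<close>

definition slice :: "(real^2) set \<Rightarrow> real set" where
  "slice C = {s. vec2 s (1 - s) \<in> C}"

lemma slice_vimage: "slice C = (\<lambda>s. vec2 s (1 - s)) -` C"
  by (auto simp: slice_def)

lemma closed_slice: "closed C \<Longrightarrow> closed (slice C)"
  unfolding slice_vimage by (rule closed_vimage) (auto intro!: continuous_intros)

lemma slice_borel [measurable]: "C \<in> sets borel \<Longrightarrow> slice C \<in> sets borel"
  unfolding slice_vimage by (rule measurable_sets_borel) auto

lemma slice_subset: "C \<subseteq> nonneg_quadrant \<Longrightarrow> slice C \<subseteq> {0..1}"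
  by (auto simp: slice_def nonneg_quadrant_two dest!: subsetD)

lemma slice_sym_diff: "slice (sym_diff A B) = sym_diff (slice A) (slice B)"
  by (auto simp: slice_def)

lemma slice_UN: "slice (\<Union>I) = (\<Union>J\<in>I. slice J)"
  by (auto simp: slice_def)

text \<open>Only positive factors occur, so the origin may be missing. This keeps the notion stable
  under symmetric difference.\<close>

definition ray_closed :: "(real^2) set \<Rightarrow> bool" where
  "ray_closed C \<longleftrightarrow> (\<forall>y r. r > 0 \<longrightarrow> y \<in> C \<longrightarrow> r *\<^sub>R y \<in> C)"

lemma ray_closed_iff:
  assumes "ray_closed C" "r > 0"
  shows "r *\<^sub>R y \<in> C \<longleftrightarrow> y \<in> C"
proof
  assume "r *\<^sub>R y \<in> C"
  then have "inverse r *\<^sub>R r *\<^sub>R y \<in> C"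
    using assms unfolding ray_closed_def by (metis inverse_positive_iff_positive)
  then show "y \<in> C" using assms by simp
qed (use assms in \<open>auto simp: ray_closed_def\<close>)

lemma ray_closed_sym_diff: "ray_closed A \<Longrightarrow> ray_closed B \<Longrightarrow> ray_closed (sym_diff A B)"
  using ray_closed_iff unfolding ray_closed_def by blast

text \<open>The two coordinates add up to \<sigma>. This removes the negative \<sigma>, over which
  the slice formula also integrates.\<close>

lemma quadrant_ray_pos:
  assumes "\<sigma> *\<^sub>R vec2 s (1 - s) \<in> nonneg_quadrant" "\<sigma> \<noteq> 0"
  shows "\<sigma> > 0"
proof -
  have "0 \<le> \<sigma> * s + \<sigma> * (1 - s)" using assms(1) by (simp add: nonneg_quadrant_two)
  then show ?thesis using assms(2) by (simp add: algebra_simps)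
qed

text \<open>The radial integral: the Jacobian \<sigma> is integrated up to the point where a linear
  form with value \<open>L\<close> on the slice reaches 1.\<close>

lemma nn_integral_ray:
  assumes "L > (0::real)"
  shows "(\<integral>\<^sup>+\<sigma>. ennreal \<bar>\<sigma>\<bar> * indicator {0<..1 / L} \<sigma> \<partial>lborel) = ennreal (1 / (2 * L\<^sup>2))"
proof -
  have "(\<integral>\<^sup>+\<sigma>. ennreal \<bar>\<sigma>\<bar> * indicator {0<..1 / L} \<sigma> \<partial>lborel) = (\<integral>\<^sup>+\<sigma>. ennreal \<sigma> * indicator {0..1 / L} \<sigma> \<partial>lborel)"
    by (rule nn_integral_cong) (auto simp: indicator_def)
  also have "\<dots> = ennreal ((1 / L)\<^sup>2 / 2 - 0\<^sup>2 / 2)"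
    by (rule nn_integral_FTC_Icc) (use assms in \<open>auto intro!: derivative_eq_intros\<close>)
  finally show ?thesis by (simp add: power_divide)
qed

lemma affine_pos:
  assumes "x \<in> pos_quadrant" "s \<in> {0..1}"
  shows "0 < x $ 0 * s + x $ 1 * (1 - s)"
proof (cases "s = 0")
  case False
  then have "0 < x $ 0 * s" "0 \<le> x $ 1 * (1 - s)" using assms by (auto simp: pos_quadrant_two)
  then show ?thesis by linarith
qed (use assms in \<open>simp add: pos_quadrant_two\<close>)

lemma emeasure_cone_truncated:
  assumes [measurable]: "C \<in> sets borel" and C: "ray_closed C" "C \<subseteq> nonneg_quadrant" and x: "x \<in> pos_quadrant"
  shows "emeasure lborel {y \<in> C. y \<bullet> x \<le> 1} =
    (\<integral>\<^sup>+s. ennreal (1 / (2 * (x $ 0 * s + x $ 1 * (1 - s))\<^sup>2)) * indicator (slice C) s \<partial>lborel)"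
proof -
  let ?T = "{y \<in> C. y \<bullet> x \<le> 1}"
  have [measurable]: "?T \<in> sets borel" by measurable
  have "emeasure lborel ?T = (\<integral>\<^sup>+y. indicator ?T y \<partial>lborel)" by simp
  also have "\<dots> = (\<integral>\<^sup>+s. \<integral>\<^sup>+\<sigma>. ennreal \<bar>\<sigma>\<bar> * indicator ?T (\<sigma> *\<^sub>R vec2 s (1 - s)) \<partial>lborel \<partial>lborel)"
    by (rule nn_integral_lborel_slices) simp
  also have "\<dots> = (\<integral>\<^sup>+s. ennreal (1 / (2 * (x $ 0 * s + x $ 1 * (1 - s))\<^sup>2)) * indicator (slice C) s \<partial>lborel)"
  proof (rule nn_integral_cong)
    fix s
    let ?L = "x $ 0 * s + x $ 1 * (1 - s)"
    show "(\<integral>\<^sup>+\<sigma>. ennreal \<bar>\<sigma>\<bar> * indicator ?T (\<sigma> *\<^sub>R vec2 s (1 - s)) \<partial>lborel) =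
      ennreal (1 / (2 * ?L\<^sup>2)) * indicator (slice C) s"
    proof (cases "s \<in> slice C")
      case True
      then have "?L > 0" using affine_pos[OF x] slice_subset[OF C(2)] by blast
      \<comment> \<open>The origin may or may not belong to \<open>C\<close>; at \<sigma> = 0 the
        Jacobian factor makes this irrelevant.\<close>
      have "(\<sigma> *\<^sub>R vec2 s (1 - s) \<in> ?T) = (\<sigma> \<in> {0<..1 / ?L})" if "\<sigma> \<noteq> 0" for \<sigma>
      proof -
        have "(\<sigma> *\<^sub>R vec2 s (1 - s)) \<bullet> x = \<sigma> * ?L" by (simp add: inner_two algebra_simps)
        moreover have "\<sigma> *\<^sub>R vec2 s (1 - s) \<in> C \<longleftrightarrow> \<sigma> > 0"
          using True ray_closed_iff[OF C(1)] quadrant_ray_pos[OF _ that] C(2) unfolding slice_def by auto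
        ultimately show ?thesis using \<open>?L > 0\<close> by (auto simp: field_simps)
      qed
      then have "ennreal \<bar>\<sigma>\<bar> * indicator ?T (\<sigma> *\<^sub>R vec2 s (1 - s)) = ennreal \<bar>\<sigma>\<bar> * indicator {0<..1 / ?L} \<sigma>" for \<sigma>
        by (cases "\<sigma> = 0") (auto simp: indicator_def)
      then show ?thesis using nn_integral_ray[OF \<open>?L > 0\<close>] True by simp
    next
      case False
      have zero: "ennreal \<bar>\<sigma>\<bar> * indicator ?T (\<sigma> *\<^sub>R vec2 s (1 - s)) = 0" for \<sigma>
      proof (cases "\<sigma> = 0")
        case False
        have "\<sigma> *\<^sub>R vec2 s (1 - s) \<notin> C"
          using ray_closed_iff[OF C(1)] quadrant_ray_pos[OF _ False] C(2) \<open>s \<notin> slice C\<close>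
          unfolding slice_def by blast
        then show ?thesis by simp
      qed simp
      show ?thesis unfolding zero using False by simp
    qed
  qed
  finally show ?thesis .
qed

text \<open>Lifts an almost-everywhere description of a slice back to the plane: almost every line
  through the origin misses \<open>C\<close> outside the origin.\<close>

lemma null_cone:
  assumes [measurable]: "C \<in> sets borel" and C: "ray_closed C" "C \<subseteq> nonneg_quadrant"
    and null: "slice C \<in> null_sets lborel"
  shows "C \<in> null_sets lborel"
proof -
  have "emeasure lborel C = (\<integral>\<^sup>+y. indicator C y \<partial>lborel)" by simp
  also have "\<dots> = (\<integral>\<^sup>+s. \<integral>\<^sup>+\<sigma>. ennreal \<bar>\<sigma>\<bar> * indicator C (\<sigma> *\<^sub>R vec2 s (1 - s)) \<partial>lborel \<partial>lborel)"
    by (rule nn_integral_lborel_slices) simp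
  also have "\<dots> = (\<integral>\<^sup>+s. 0 \<partial>(lborel :: real measure))"
  proof (rule nn_integral_cong_AE, rule AE_mp[OF AE_not_in[OF null]], intro AE_I2 impI)
    fix s assume "s \<notin> slice C"
    have zero: "ennreal \<bar>\<sigma>\<bar> * indicator C (\<sigma> *\<^sub>R vec2 s (1 - s)) = 0" for \<sigma>
    proof (cases "\<sigma> = 0")
      case False
      have "\<sigma> *\<^sub>R vec2 s (1 - s) \<notin> C"
        using ray_closed_iff[OF C(1)] quadrant_ray_pos[OF _ False] C(2) \<open>s \<notin> slice C\<close>
        unfolding slice_def by blast
      then show ?thesis by simp
    qed simp
    show "(\<integral>\<^sup>+\<sigma>. ennreal \<bar>\<sigma>\<bar> * indicator C (\<sigma> *\<^sub>R vec2 s (1 - s)) \<partial>lborel) = 0"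
      unfolding zero by simp
  qed
  finally show ?thesis by (auto intro: null_setsI)
qed

text \<open>Twice the area of the truncated cone over \<open>K\<close>; the factor 1/2 of the radial
  integral is split off.\<close>

definition slice_integral :: "real set \<Rightarrow> real^2 \<Rightarrow> real" where
  "slice_integral K x = (LINT s:K|lborel. 1 / (x $ 0 * s + x $ 1 * (1 - s))\<^sup>2)"

lemma measure_cone_truncated:
  assumes [measurable]: "C \<in> sets borel" and C: "ray_closed C" "C \<subseteq> nonneg_quadrant" and x: "x \<in> pos_quadrant"
  shows "measure lebesgue {y \<in> C. y \<bullet> x \<le> 1} = slice_integral (slice C) x / 2"
proof -
  have "slice_integral (slice C) x / 2 =
    (\<integral>s. 1 / (2 * (x $ 0 * s + x $ 1 * (1 - s))\<^sup>2) * indicator (slice C) s \<partial>lborel)"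
    unfolding slice_integral_def set_lebesgue_integral_def
    by (subst integral_divide_zero[symmetric]) (auto intro!: Bochner_Integration.integral_cong)
  also have "\<dots> = enn2real (emeasure lborel {y \<in> C. y \<bullet> x \<le> 1})"
    unfolding emeasure_cone_truncated[OF assms]
    by (subst integral_eq_nn_integral)
       (auto intro!: arg_cong[where f = enn2real] nn_integral_cong simp: ennreal_mult'' indicator_def)
  finally show ?thesis
    by (simp add: measure_def emeasure_completion)
qed

subsection \<open>Moments of a subset of the unit interval\<close>

lemma pderiv_sum': "pderiv (\<Sum>i\<in>A. f i) = (\<Sum>i\<in>A. pderiv (f i :: real poly))"
  by (induction A rule: infinite_finite_induct) (auto simp: pderiv_add)

text \<open>Termwise antiderivative. It turns an approximation of a derivative into an approximation
  of the function in \<open>annihilated_C1\<close>.\<close>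

lemma pderiv_surj: "\<exists>p. pderiv p = (r :: real poly)"
proof -
  let ?p = "\<Sum>i\<le>degree r. monom (coeff r i / real (Suc i)) (Suc i)"
  have "pderiv ?p = (\<Sum>i\<le>degree r. monom (coeff r i) i)"
    by (simp add: pderiv_sum' pderiv_monom del: of_nat_Suc)
  also have "\<dots> = r" by (rule poly_as_sum_of_monoms)
  finally show ?thesis ..
qed

lemma real_polynomial_function_imp_poly:
  fixes f :: "real \<Rightarrow> real"
  assumes "real_polynomial_function f"
  obtains p where "\<And>x. f x = poly p x"
proof -
  obtain a n where "f = (\<lambda>x. \<Sum>i\<le>n. a i * x ^ i)"
    using assms real_polynomial_function_iff_sum by blast
  then have "f x = poly (\<Sum>i\<le>n. monom (a i) i) x" for x
    by (simp add: poly_sum poly_monom)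
  then show ?thesis by (rule that)
qed

text \<open>Once the lower coefficients of the difference vanish, dividing by \<open>w ^ n\<close>
  and letting \<open>w\<close> tend to 0 isolates the next one.\<close>

lemma powser_coeff_unique:
  fixes a b :: "nat \<Rightarrow> real"
  assumes "r > 0"
    and a: "\<And>w. \<bar>w\<bar> < r \<Longrightarrow> (\<lambda>n. a n * w ^ n) sums f w"
    and b: "\<And>w. \<bar>w\<bar> < r \<Longrightarrow> (\<lambda>n. b n * w ^ n) sums f w"
  shows "a = b"
proof -
  define c where "c n = a n - b n" for n
  have c: "(\<lambda>n. c n * w ^ n) sums 0" if "\<bar>w\<bar> < r" for w
    using sums_diff[OF a[OF that] b[OF that]] by (simp add: c_def left_diff_distrib)
  have "c n = 0" for n
  proof (induction n rule: less_induct)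
    case (less n)
    have "((\<lambda>_. 0) \<longlongrightarrow> c (0 + n)) (at (0::real))"
    proof (rule powser_limit_0_strong[OF \<open>r > 0\<close>])
      fix w :: real assume w: "w \<noteq> 0" "norm w < r"
      have "(\<lambda>k. c (k + n) * w ^ (k + n)) sums (0 - (\<Sum>k<n. c k * w ^ k))"
        using c[of w] w by (intro sums_split_initial_segment) auto
      then have "(\<lambda>k. c (k + n) * w ^ (k + n) / w ^ n) sums (0 / w ^ n)"
        using less.IH by (intro sums_divide) simp
      then show "(\<lambda>k. c (k + n) * w ^ k) sums 0" using w by (simp add: power_add)
    qed
    then show ?case by (simp add: tendsto_const_iff)
  qed
  then show ?thesis by (auto simp: c_def)
qed

section \<open>Integration over a Borel subset of the unit interval\<close>

locale unit_interval_set =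
  fixes K :: "real set"
  assumes K_borel [measurable]: "K \<in> sets borel" and K_sub: "K \<subseteq> {0..1}"
begin

text \<open>The indicator of \<open>K\<close> as a linear functional. With the space restricted to
  \<open>K\<close>, continuity on \<open>{0..1}\<close> already gives measurability.\<close>

definition J :: "(real \<Rightarrow> real) \<Rightarrow> real" where
  "J h = (\<integral>s. h s \<partial>restrict_space lborel K)"

lemma finite_measure_K: "finite_measure (restrict_space lborel K)"
proof (rule finite_measureI)
  have "emeasure lborel K \<le> emeasure lborel {0..1::real}" by (rule emeasure_mono) (use K_sub in auto)
  then show "emeasure (restrict_space lborel K) (space (restrict_space lborel K)) \<noteq> \<infinity>"
    by (subst emeasure_restrict_space) (auto simp: space_restrict_space top_unique)
qed

lemma space_K: "space (restrict_space lborel K) = K"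
  by (simp add: space_restrict_space)

lemma integrable_bounded:
  assumes "h \<in> borel_measurable (restrict_space lborel K)" "\<And>s. s \<in> {0..1} \<Longrightarrow> \<bar>h s\<bar> \<le> (B::real)"
  shows "integrable (restrict_space lborel K) h"
  using assms K_sub
  by (intro finite_measure.integrable_const_bound[OF finite_measure_K, of _ B] AE_I2)
     (auto simp: space_K)

lemma measurable_continuous:
  fixes h :: "real \<Rightarrow> real"
  assumes "continuous_on {0..1} h"
  shows "h \<in> borel_measurable (restrict_space lborel K)"
proof -
  have "h \<in> borel_measurable (restrict_space borel K)"
    using assms K_sub continuous_on_subset by (blast intro: borel_measurable_continuous_on_restrict)
  then show ?thesis
    by (subst measurable_cong_sets[OF sets_restrict_space_cong[OF sets_lborel] refl])
qed

lemma integrable_continuous: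
  fixes h :: "real \<Rightarrow> real"
  assumes "continuous_on {0..1} h"
  shows "integrable (restrict_space lborel K) h"
proof -
  have "bounded (h ` {0..1})"
    using assms by (intro compact_imp_bounded compact_continuous_image) auto
  then obtain B where "\<And>s. s \<in> {0..1} \<Longrightarrow> \<bar>h s\<bar> \<le> B"
    unfolding bounded_iff by (metis imageI real_norm_def)
  then show ?thesis using measurable_continuous[OF assms] integrable_bounded by blast
qed

lemma integrable_poly: "integrable (restrict_space lborel K) (poly p)"
  by (intro integrable_continuous continuous_intros)

lemma measure_K_le: "measure lborel K \<le> 1"
proof -
  have "measure lborel K \<le> measure lborel {0..1::real}"
    by (rule measure_mono_fmeasurable) (use K_sub in \<open>auto simp: fmeasurable_def\<close>)
  then show ?thesis by simp
qed

lemma J_bound: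
  assumes "\<And>s. s \<in> {0..1} \<Longrightarrow> \<bar>h s\<bar> \<le> B" "h \<in> borel_measurable (restrict_space lborel K)"
  shows "\<bar>J h\<bar> \<le> B"
proof -
  have "0 \<le> B" using assms(1)[of 0] by auto
  have "norm (J h) \<le> (\<integral>s. B \<partial>restrict_space lborel K)"
    unfolding J_def
    by (rule Bochner_Integration.integral_norm_bound_integral)
       (use assms K_sub in \<open>auto simp del: atLeastAtMost_iff simp: space_K intro!: integrable_bounded[of h B] finite_measure.integrable_const[OF finite_measure_K]\<close>)
  also have "\<dots> = B * measure lborel K"
    by (simp add: space_K measure_restrict_space)
  also have "\<dots> \<le> B" using measure_K_le \<open>0 \<le> B\<close> by (simp add: mult_left_le)
  finally show ?thesis by simp
qed

text \<open>Integrates the derived geometric series in \<open>w * s\<close> term by term; the terms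
  are dominated by those of the same series at \<bar>w\<bar>.\<close>

lemma generating_function_sums:
  assumes "\<bar>w\<bar> < 1"
  shows "(\<lambda>n. real (Suc n) * J (\<lambda>s. s ^ n) * w ^ n) sums J (\<lambda>s. 1 / (1 - w * s)\<^sup>2)"
proof -
  have bnd: "\<bar>real (Suc n) * s ^ n * w ^ n\<bar> \<le> real (Suc n) * \<bar>w\<bar> ^ n" if "s \<in> {0..1}" for s n
    using that power_le_one[of s n] by (auto simp: abs_mult power_abs intro!: mult_right_mono mult_left_le mult_left_le_one_le)
  have geo: "(\<lambda>n. of_nat (Suc n) * z ^ n) sums (1 / (1 - z)\<^sup>2)" if "\<bar>z\<bar> < 1" for z :: real
    using geometric_deriv_sums[of z] that by simp
  have int: "integrable (restrict_space lborel K) (\<lambda>s. real (Suc n) * s ^ n * w ^ n)" for n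
    by (intro integrable_continuous continuous_intros)
  have "(\<lambda>n. \<integral>s. real (Suc n) * s ^ n * w ^ n \<partial>restrict_space lborel K) sums
      (\<integral>s. (\<Sum>n. real (Suc n) * s ^ n * w ^ n) \<partial>restrict_space lborel K)"
  proof (rule sums_integral[OF int])
    have summ: "summable (\<lambda>n. real (Suc n) * \<bar>w\<bar> ^ n)"
      using geo[of "\<bar>w\<bar>"] assms sums_summable by fastforce
    show "AE s in restrict_space lborel K. summable (\<lambda>n. norm (real (Suc n) * s ^ n * w ^ n))"
      using bnd K_sub by (intro AE_I2 summable_comparison_test'[OF summ, of 0]) (auto simp: space_K)
    show "summable (\<lambda>n. \<integral>s. norm (real (Suc n) * s ^ n * w ^ n) \<partial>restrict_space lborel K)"
    proof (rule summable_comparison_test'[OF summ, of 0])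
      fix n
      have "\<bar>J (\<lambda>s. norm (real (Suc n) * s ^ n * w ^ n))\<bar> \<le> real (Suc n) * \<bar>w\<bar> ^ n"
      proof (rule J_bound)
        show "(\<lambda>s. norm (real (Suc n) * s ^ n * w ^ n)) \<in> borel_measurable (restrict_space lborel K)"
          by (intro measurable_continuous continuous_intros)
      qed (use bnd in simp)
      then show "norm (\<integral>s. norm (real (Suc n) * s ^ n * w ^ n) \<partial>restrict_space lborel K) \<le> real (Suc n) * \<bar>w\<bar> ^ n"
        unfolding J_def by simp
    qed
  qed
  also have "(\<lambda>n. \<integral>s. real (Suc n) * s ^ n * w ^ n \<partial>restrict_space lborel K) = (\<lambda>n. real (Suc n) * J (\<lambda>s. s ^ n) * w ^ n)"
    by (simp add: J_def mult.assoc del: of_nat_Suc)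
  also have "(\<integral>s. (\<Sum>n. real (Suc n) * s ^ n * w ^ n) \<partial>restrict_space lborel K) = J (\<lambda>s. 1 / (1 - w * s)\<^sup>2)"
    unfolding J_def
  proof (rule Bochner_Integration.integral_cong[OF refl])
    fix s assume "s \<in> space (restrict_space lborel K)"
    then have "0 \<le> s" "s \<le> 1" using K_sub by (auto simp: space_K)
    then have "\<bar>w * s\<bar> < 1" using assms mult_left_le[of s "\<bar>w\<bar>"] by (simp add: abs_mult)
    from sums_unique[OF geo[OF this]] show "(\<Sum>n. real (Suc n) * s ^ n * w ^ n) = 1 / (1 - w * s)\<^sup>2"
      by (simp add: power_mult_distrib mult_ac)
  qed
  finally show ?thesis .
qed

text \<open>Comparing the coefficients of \<open>w ^ n\<close> in \<open>q w * J (\<lambda>s. 1 / (1 - w * s)\<^sup>2) = p w\<close> for \<open>n > degree p\<close>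
  gives a linear recurrence for the moments of \<open>K\<close>, which is the claim for \<open>r\<close> a power.\<close>

lemma rational_imp_annihilated:
  assumes eq: "\<And>w. \<bar>w\<bar> < 1 \<Longrightarrow> poly q w * J (\<lambda>s. 1 / (1 - w * s)\<^sup>2) = poly p w"
    and "q \<noteq> 0"
  obtains B where "B \<noteq> 0" "\<And>r. J (poly (pderiv (r * B))) = 0"
proof -
  define m where "m n = J (\<lambda>s. s ^ n)" for n
  define d where "d = degree q"
  \<comment> \<open>One extra power moves the index of the recurrence past \<open>degree p\<close>,
    the other is consumed by \<open>pderiv\<close>. In \<open>B\<close>, the reflection reverses the
    coefficients of \<open>q\<close> to match the convolution \<open>c\<close>.\<close>
  define N where "N = Suc (Suc (degree p))"
  define B where "B = monom 1 N * reflect_poly q"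
  define c where "c n = (\<Sum>j\<le>n. coeff q j * (real (Suc (n - j)) * m (n - j)))" for n
  have poly_sums: "(\<lambda>n. coeff r n * w ^ n) sums poly r w" for r and w :: real
    unfolding poly_altdef by (rule sums_finite) (auto simp: coeff_eq_0)
  have "(\<lambda>n. c n * w ^ n) sums poly p w" if w: "\<bar>w\<bar> < 1" for w
  proof -
    let ?a = "\<lambda>n. coeff q n * w ^ n" and ?b = "\<lambda>n. real (Suc n) * m n * w ^ n"
    have gs: "?b sums J (\<lambda>s. 1 / (1 - w * s)\<^sup>2)"
      using generating_function_sums[OF w] by (simp add: m_def)
    have "summable (\<lambda>n. norm (?a n))"
      by (rule summable_finite[of "{..degree q}"]) (auto simp: coeff_eq_0)
    moreover have "summable (\<lambda>n. norm (?b n))"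
    proof -
      \<comment> \<open>Convergence at a slightly larger radius gives absolute convergence at
        \<open>w\<close>.\<close>
      obtain v where v: "\<bar>w\<bar> < v" "v < 1" using w dense by blast
      have "summable (\<lambda>n. real (Suc n) * m n * v ^ n)"
        using generating_function_sums[of v] v by (auto simp: m_def sums_iff)
      from powser_insidea[OF this, of w] v show ?thesis by auto
    qed
    ultimately have "(\<lambda>n. \<Sum>j\<le>n. ?a j * ?b (n - j)) sums ((\<Sum>n. ?a n) * (\<Sum>n. ?b n))"
      by (rule Cauchy_product_sums)
    also have "(\<Sum>n. ?a n) * (\<Sum>n. ?b n) = poly p w"
      using eq[OF w] sums_unique[OF gs] sums_unique[OF poly_sums[of q w]] by simp
    also have "(\<lambda>n. \<Sum>j\<le>n. ?a j * ?b (n - j)) = (\<lambda>n. c n * w ^ n)"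
    proof
      fix n
      show "(\<Sum>j\<le>n. ?a j * ?b (n - j)) = c n * w ^ n"
        unfolding c_def sum_distrib_right
      proof (rule sum.cong[OF refl])
        fix j assume "j \<in> {..n}"
        then have "w ^ n = w ^ j * w ^ (n - j)" by (simp flip: power_add)
        then show "?a j * ?b (n - j) = coeff q j * (real (Suc (n - j)) * m (n - j)) * w ^ n" by simp
      qed
    qed
    finally show ?thesis .
  qed
  then have "c = coeff p"
    using poly_sums by (intro powser_coeff_unique[of 1 _ "poly p"]) auto
  then have c0: "c n = 0" if "n > degree p" for n using that by (simp add: coeff_eq_0)
  have power: "J (poly (pderiv (monom 1 k * B))) = 0" for k
  proof -
    define n where "n = Suc (k + degree p + d)"
    have "monom 1 k * B = (\<Sum>j\<le>d. monom (coeff q j) (Suc (n - j)))"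
    proof -
      have "reflect_poly q = (\<Sum>i\<le>d. monom (coeff (reflect_poly q) i) i)"
        by (rule poly_as_sum_of_monoms'[symmetric]) (simp add: d_def degree_reflect_poly_le)
      also have "\<dots> = (\<Sum>i\<le>d. monom (coeff q (d - i)) i)"
        by (rule sum.cong) (auto simp: coeff_reflect_poly d_def)
      also have "\<dots> = (\<Sum>j\<le>d. monom (coeff q j) (d - j))"
        by (rule sum.reindex_bij_witness[where i = "\<lambda>j. d - j" and j = "\<lambda>j. d - j"]) auto
      finally have "monom 1 k * B = monom 1 (k + N) * (\<Sum>j\<le>d. monom (coeff q j) (d - j))"
        by (simp add: B_def mult_monom flip: mult.assoc)
      also have "\<dots> = (\<Sum>j\<le>d. monom (coeff q j) (Suc (n - j)))"
        unfolding sum_distrib_left by (rule sum.cong) (auto simp: mult_monom N_def n_def Suc_diff_le)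
      finally show ?thesis .
    qed
    then have "poly (pderiv (monom 1 k * B)) = (\<lambda>s. \<Sum>j\<le>d. coeff q j * (real (Suc (n - j)) * s ^ (n - j)))"
      by (simp add: pderiv_sum' pderiv_monom poly_sum poly_monom fun_eq_iff mult_ac del: of_nat_Suc)
    then have "J (poly (pderiv (monom 1 k * B))) = (\<Sum>j\<le>d. coeff q j * (real (Suc (n - j)) * m (n - j)))"
      unfolding J_def m_def
      by (simp add: integrable_continuous continuous_intros del: of_nat_Suc)
    also have "\<dots> = c n"
      unfolding c_def by (rule sum.mono_neutral_left) (auto simp: n_def d_def coeff_eq_0)
    finally show ?thesis by (simp add: c0 n_def)
  qed
  show ?thesis
  proof (rule that[of B])
    show "B \<noteq> 0" using \<open>q \<noteq> 0\<close> by (simp add: B_def)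
    fix r :: "real poly"
    have "r = (\<Sum>i\<le>degree r. smult (coeff r i) (monom 1 i))"
      by (simp add: smult_monom poly_as_sum_of_monoms)
    then have "r * B = (\<Sum>i\<le>degree r. smult (coeff r i) (monom 1 i * B))"
      by (metis (no_types, lifting) mult_smult_left sum.cong sum_distrib_right)
    then have "poly (pderiv (r * B)) = (\<lambda>s. \<Sum>i\<le>degree r. coeff r i * poly (pderiv (monom 1 i * B)) s)"
      by (simp add: pderiv_sum' pderiv_smult poly_sum fun_eq_iff)
    then have "J (poly (pderiv (r * B))) = (\<Sum>i\<le>degree r. coeff r i * J (poly (pderiv (monom 1 i * B))))"
      unfolding J_def by (simp add: integrable_poly)
    then show "J (poly (pderiv (r * B))) = 0" by (simp add: power)
  qed
qed

text \<open>The integrand is the derivative of \<open>f\<close> times \<open>B\<close>. A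
  Weierstrass approximation \<open>r\<close> of \<open>g\<close>, integrated from the initial value
  \<open>f 0\<close>, is uniformly close to \<open>f\<close> too, so both terms of the product rule
  are approximated by those of a polynomial.\<close>

lemma annihilated_C1:
  assumes B: "\<And>r. J (poly (pderiv (r * B))) = 0"
    and f: "\<And>x. x \<in> {0..1} \<Longrightarrow> (f has_real_derivative g x) (at x within {0..1})"
    and g: "continuous_on {0..1} g"
  shows "J (\<lambda>s. g s * poly B s + f s * poly (pderiv B) s) = 0"
proof -
  define F where "F = (\<lambda>s. g s * poly B s + f s * poly (pderiv B) s)"
  have cf: "continuous_on {0..1} f" using f by (rule DERIV_continuous_on)
  have bd: "\<exists>c. \<forall>s\<in>{0..1}. \<bar>poly r s\<bar> \<le> c" for r :: "real poly"
  proof -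
    have "bounded (poly r ` {0..1})"
      by (intro compact_imp_bounded compact_continuous_image continuous_intros) auto
    then show ?thesis unfolding bounded_iff by auto
  qed
  obtain c1 where c1: "\<And>s. s \<in> {0..1} \<Longrightarrow> \<bar>poly B s\<bar> \<le> c1" using bd by blast
  obtain c2 where c2: "\<And>s. s \<in> {0..1} \<Longrightarrow> \<bar>poly (pderiv B) s\<bar> \<le> c2" using bd by blast
  have nn: "0 \<le> c1" "0 \<le> c2" using c1[of 0] c2[of 0] by auto
  have "\<bar>J F\<bar> \<le> e * (c1 + c2)" if "e > 0" for e
  proof -
    obtain r0 where rp: "real_polynomial_function r0" and r0: "\<And>x. x \<in> {0..1} \<Longrightarrow> \<bar>g x - r0 x\<bar> < e"
      by (rule Stone_Weierstrass_real_polynomial_function[OF compact_Icc g \<open>e > 0\<close>]) blast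
    obtain r where "\<And>x. r0 x = poly r x" by (rule real_polynomial_function_imp_poly[OF rp]) blast
    then have r: "\<bar>g x - poly r x\<bar> \<le> e" if "x \<in> {0..1}" for x using r0[OF that] by simp
    obtain p0 where p0: "pderiv p0 = r" using pderiv_surj by blast
    define p where "p = p0 + [:f 0 - poly p0 0:]"
    have p: "pderiv p = r" by (simp add: p_def p0 pderiv_add)
    have p': "poly p 0 = f 0" by (simp add: p_def)
    have fp: "\<bar>f x - poly p x\<bar> \<le> e" if x: "x \<in> {0..1}" for x
    proof -
      have "norm ((f x - poly p x) - (f 0 - poly p 0)) \<le> e * norm (x - 0)"
      proof (rule field_differentiable_bound[of "{0..1}" _ "\<lambda>x. g x - poly r x"])
        show "((\<lambda>x. f x - poly p x) has_real_derivative g z - poly r z) (at z within {0..1})" if "z \<in> {0..1}" for z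
          using DERIV_diff[OF f[OF that] has_field_derivative_at_within[OF poly_DERIV[of p z]]] by (simp add: p)
      qed (use r x in auto)
      also have "\<dots> \<le> e" using x \<open>e > 0\<close> by (simp add: mult_left_le)
      finally show ?thesis by (simp add: p')
    qed
    have "J F = J (\<lambda>s. F s - poly (pderiv (p * B)) s)"
      using B[of p] cf g unfolding J_def F_def
      by (subst Bochner_Integration.integral_diff)
         (auto intro!: integrable_continuous integrable_poly continuous_intros)
    moreover have "\<bar>J (\<lambda>s. F s - poly (pderiv (p * B)) s)\<bar> \<le> e * (c1 + c2)"
    proof (rule J_bound)
      fix s :: real assume s: "s \<in> {0..1}"
      have "F s - poly (pderiv (p * B)) s = (g s - poly r s) * poly B s + (f s - poly p s) * poly (pderiv B) s"
        by (simp add: F_def pderiv_mult p algebra_simps)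
      also have "\<bar>\<dots>\<bar> \<le> \<bar>g s - poly r s\<bar> * \<bar>poly B s\<bar> + \<bar>f s - poly p s\<bar> * \<bar>poly (pderiv B) s\<bar>"
        by (metis abs_mult abs_triangle_ineq)
      also have "\<dots> \<le> e * c1 + e * c2"
        using r[OF s] fp[OF s] c1[OF s] c2[OF s] \<open>e > 0\<close> by (intro add_mono mult_mono) auto
      finally show "\<bar>F s - poly (pderiv (p * B)) s\<bar> \<le> e * (c1 + c2)" by (simp add: algebra_simps)
    qed (use cf g in \<open>auto simp: F_def intro!: measurable_continuous continuous_intros\<close>)
    ultimately show ?thesis by simp
  qed
  then have "\<bar>J F\<bar> \<le> 0"
  proof -
    assume *: "\<And>e. e > 0 \<Longrightarrow> \<bar>J F\<bar> \<le> e * (c1 + c2)"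
    show ?thesis
    proof (rule field_le_epsilon)
      fix e :: real assume "e > 0"
      \<comment> \<open>The added 1 keeps the denominator positive if both bounds are 0.\<close>
      have "\<bar>J F\<bar> \<le> e / (c1 + c2 + 1) * (c1 + c2)" using \<open>e > 0\<close> nn by (intro *) auto
      also have "\<dots> \<le> e" using \<open>e > 0\<close> nn by (simp add: field_simps)
      finally show "\<bar>J F\<bar> \<le> 0 + e" by simp
    qed
  qed
  then show ?thesis by (simp add: F_def)
qed

end

subsection \<open>From polynomials to open sets\<close>

text \<open>Continuous functions with compact support in the open interval. The margin \<delta>
  allows division by a polynomial that has roots at the endpoints.\<close>

definition test_fun :: "real \<Rightarrow> real \<Rightarrow> (real \<Rightarrow> real) \<Rightarrow> bool" where
  "test_fun a b h \<longleftrightarrow> continuous_on UNIV h \<and> (\<exists>\<delta>>0. \<forall>x. x \<le> a + \<delta> \<or> b - \<delta> \<le> x \<longrightarrow> h x = 0)"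

lemma test_fun_lincomb:
  assumes "test_fun a b g" "test_fun a b h"
  shows "test_fun a b (\<lambda>x. g x * c - h x * d)"
proof -
  obtain \<delta> where \<delta>: "\<delta> > 0" "\<And>x. x \<le> a + \<delta> \<or> b - \<delta> \<le> x \<Longrightarrow> g x = 0"
    using assms(1) by (auto simp: test_fun_def)
  obtain \<eta> where \<eta>: "\<eta> > 0" "\<And>x. x \<le> a + \<eta> \<or> b - \<eta> \<le> x \<Longrightarrow> h x = 0"
    using assms(2) by (auto simp: test_fun_def)
  have "g x * c - h x * d = 0" if "x \<le> a + min \<delta> \<eta> \<or> b - min \<delta> \<eta> \<le> x" for x
  proof -
    have "x \<le> a + \<delta> \<or> b - \<delta> \<le> x" "x \<le> a + \<eta> \<or> b - \<eta> \<le> x" using that by auto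
    then show ?thesis using \<delta>(2)[of x] \<eta>(2)[of x] by simp
  qed
  moreover have "min \<delta> \<eta> > 0" using \<delta> \<eta> by simp
  moreover have "continuous_on UNIV (\<lambda>x. g x * c - h x * d)"
    using assms unfolding test_fun_def by (intro continuous_intros) auto
  ultimately show ?thesis unfolding test_fun_def by blast
qed

text \<open>A continuous approximation of the indicator of \<open>U\<close>. Subtracting 1 makes it
  vanish up to distance \<open>1 / Suc n\<close> from the complement, which supplies the margin of a
  test function; it is 1 from distance \<open>2 / Suc n\<close> on.\<close>

definition plateau :: "real set \<Rightarrow> nat \<Rightarrow> real \<Rightarrow> real" where
  "plateau U n x = min 1 (max 0 (real (Suc n) * infdist x (- U) - 1))"

lemma plateau_test_fun:
  assumes "U \<subseteq> {a<..<b}"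
  shows "test_fun a b (plateau U n)"
  unfolding test_fun_def
proof (intro conjI exI[of _ "1 / real (Suc n)"] allI impI)
  show "continuous_on UNIV (plateau U n)"
    unfolding plateau_def by (intro continuous_intros)
  fix x assume x: "x \<le> a + 1 / real (Suc n) \<or> b - 1 / real (Suc n) \<le> x"
  have "infdist x (- U) \<le> 1 / real (Suc n)"
  proof (cases "x \<in> U")
    case True
    then have "a < x" "x < b" using assms by auto
    have "a \<in> - U" "b \<in> - U" using assms by auto
    from infdist_le[OF this(1), of x] infdist_le[OF this(2), of x] show ?thesis
      using x \<open>a < x\<close> \<open>x < b\<close> by (auto simp: dist_real_def)
  qed (simp add: infdist_zero)
  then show "plateau U n x = 0" by (simp add: plateau_def field_simps del: of_nat_Suc)
qed simp

lemma plateau_bound: "\<bar>plateau U n x\<bar> \<le> 1"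
  by (simp add: plateau_def)

text \<open>A point of an open set has positive distance to the complement. \<open>UNIV\<close> is
  excluded because \<open>infdist\<close> to the empty set is 0.\<close>

lemma plateau_tendsto:
  assumes "open U" "U \<noteq> UNIV"
  shows "(\<lambda>n. plateau U n x) \<longlonglongrightarrow> indicator U x"
proof (cases "x \<in> U")
  case True
  have "infdist x (- U) > 0"
    using True assms by (intro infdist_pos_not_in_closed) auto
  then obtain N where N: "2 < real N * infdist x (- U)" using reals_Archimedean3 by blast
  have "plateau U n x = 1" if "n \<ge> N" for n
  proof -
    have "real N * infdist x (- U) \<le> real (Suc n) * infdist x (- U)"
      using that \<open>infdist x (- U) > 0\<close> by (intro mult_right_mono) auto
    then show ?thesis using N by (simp add: plateau_def del: of_nat_Suc)
  qed
  then have "eventually (\<lambda>n. plateau U n x = 1) sequentially" by (auto simp: eventually_sequentially)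
  then show ?thesis using True by (simp add: tendsto_eventually)
qed (simp add: plateau_def infdist_zero)

context unit_interval_set begin

text \<open>The primitive \<psi> of a test function of integral zero again vanishes near the
  endpoints and beyond them. Hence \<psi> divided by \<open>B\<close> is continuously differentiable
  on the whole unit interval, and multiplying it by \<open>B\<close> and differentiating gives back
  \<open>h\<close>, so that \<open>annihilated_C1\<close> applies.\<close>

lemma J_test_fun_zero:
  assumes ann: "\<And>r. J (poly (pderiv (r * B))) = 0"
    and ab: "0 \<le> a" "b \<le> 1"
    and B: "\<And>x. x \<in> {a<..<b} \<Longrightarrow> poly B x \<noteq> 0"
    and h: "test_fun a b h" "integral {0..1} h = 0"
  shows "J h = 0"
proof -
  obtain \<delta> where \<delta>: "\<delta> > 0" "\<And>x. x \<le> a + \<delta> \<or> b - \<delta> \<le> x \<Longrightarrow> h x = 0"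
    using h(1) by (auto simp: test_fun_def)
  have ch: "continuous_on A h" for A
    using h(1) continuous_on_subset[of UNIV h A] by (simp add: test_fun_def)
  define \<psi> where "\<psi> x = integral {0..x} h" for x
  \<comment> \<open>Division by zero yields 0, so \<open>f\<close> and \<open>g\<close> are already
    extended by zero at the roots of \<open>B\<close>.\<close>
  define f where "f x = \<psi> x / poly B x" for x
  define g where "g x = (h x * poly B x - \<psi> x * poly (pderiv B) x) / (poly B x * poly B x)" for x
  have d\<psi>: "(\<psi> has_real_derivative h x) (at x within {0..1})" if "x \<in> {0..1}" for x
    unfolding \<psi>_def by (rule integral_has_real_derivative[OF ch that])
  have zero: "\<psi> x = 0" if "x \<in> {0..1}" "x \<le> a + \<delta> \<or> b - \<delta> \<le> x" for x
    using that(2)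
  proof
    assume "x \<le> a + \<delta>"
    then have "(h has_integral 0) {0..x}" by (intro has_integral_is_0) (auto intro: \<delta>(2))
    then show ?thesis by (auto simp: \<psi>_def)
  next
    \<comment> \<open>To the right of the support, \<psi> equals the total integral of
      \<open>h\<close>, which is zero.\<close>
    assume "b - \<delta> \<le> x"
    then have "(h has_integral 0) {x..1}" by (intro has_integral_is_0) (auto intro: \<delta>(2))
    moreover have "integral {0..x} h + integral {x..1} h = integral {0..1} h"
      using that(1) by (intro Henstock_Kurzweil_Integration.integral_combine integrable_continuous_real ch) auto
    ultimately show ?thesis using h(2) integral_unique[of h 0 "{x..1}"] by (simp add: \<psi>_def)
  qed
  have near: "\<psi> y = 0 \<and> h y = 0" if "poly B x = 0" "y \<in> {0..1}" "dist y x < \<delta>" for x y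
  proof -
    have "x \<le> a \<or> b \<le> x" using B[of x] that(1) by force
    then have "y \<le> a + \<delta> \<or> b - \<delta> \<le> y" using that(3) by (auto simp: dist_real_def)
    then show ?thesis using zero that(2) \<delta>(2) by blast
  qed
  have df: "(f has_real_derivative g x) (at x within {0..1})" if x: "x \<in> {0..1}" for x
  proof (cases "poly B x = 0")
    case True
    have "((\<lambda>_. 0) has_real_derivative g x) (at x within {0..1})" by (simp add: g_def True)
    then show ?thesis
      by (rule has_field_derivative_transform_within[OF _ \<delta>(1) x]) (use near[OF True] in \<open>auto simp: f_def\<close>)
  next
    case False
    show ?thesis unfolding f_def g_def
      by (rule DERIV_divide[OF d\<psi>[OF x] has_field_derivative_at_within[OF poly_DERIV] False])
  qed
  have cg: "continuous_on {0..1} g"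
    unfolding continuous_on_eq_continuous_within
  proof
    fix x :: real assume x: "x \<in> {0..1}"
    show "continuous (at x within {0..1}) g"
    proof (cases "poly B x = 0")
      case True
      have "continuous (at x within {0..1}) (\<lambda>_. 0::real)" by simp
      then show ?thesis
        by (rule continuous_transform_within[OF _ \<delta>(1) x]) (use near[OF True] in \<open>auto simp: g_def\<close>)
    next
      case False
      have "continuous (at x within {0..1}) \<psi>"
        using DERIV_continuous[OF d\<psi>[OF x]] .
      moreover have "continuous (at x within {0..1}) h"
        using ch[of "{0..1}"] x by (simp add: continuous_on_eq_continuous_within)
      moreover have "continuous (at x within {0..1}) (poly p)" for p
        using poly_isCont continuous_at_imp_continuous_within by blast
      ultimately show ?thesis unfolding g_def
        using False by (intro continuous_at_within_divide continuous_diff continuous_mult) auto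
    qed
  qed
  have "J h = J (\<lambda>s. g s * poly B s + f s * poly (pderiv B) s)"
    unfolding J_def
  proof (rule Bochner_Integration.integral_cong[OF refl])
    fix s assume "s \<in> space (restrict_space lborel K)"
    then have s: "s \<in> {0..1}" using K_sub by (auto simp: space_K)
    show "h s = g s * poly B s + f s * poly (pderiv B) s"
    proof (cases "poly B s = 0")
      case True
      then show ?thesis using near[OF True s] \<delta>(1) by (simp add: f_def g_def)
    next
      case False
      then show ?thesis by (simp add: f_def g_def field_simps)
    qed
  qed
  then show ?thesis using annihilated_C1[OF ann df cg] by simp
qed

lemma J_plateau_tendsto:
  assumes "open U" "U \<noteq> UNIV"
  shows "(\<lambda>n. J (plateau U n)) \<longlonglongrightarrow> measure lborel (K \<inter> U)"
proof -
  have [measurable]: "U \<in> sets borel" using assms by simp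
  have [measurable]: "indicator U \<in> borel_measurable (restrict_space lborel K)"
    by (intro measurable_restrict_space1) simp
  have "(\<lambda>n. J (plateau U n)) \<longlonglongrightarrow> J (indicator U)"
    unfolding J_def
  proof (rule integral_dominated_convergence[where w = "\<lambda>_. 1"])
    show "plateau U n \<in> borel_measurable (restrict_space lborel K)" for n
      unfolding plateau_def by (intro measurable_continuous continuous_intros)
    show "integrable (restrict_space lborel K) (\<lambda>_. 1 :: real)"
      by (rule finite_measure.integrable_const[OF finite_measure_K])
  qed (use assms plateau_tendsto plateau_bound in auto)
  also have "J (indicator U) = measure lborel (K \<inter> U)"
    unfolding J_def by (simp add: space_K measure_restrict_space Int_commute)
  finally show ?thesis .
qed

end

text \<open>For the full interval the functional is ordinary integration, the reference against
  which \<open>K\<close> is compared.\<close>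

interpretation unit: unit_interval_set "{0..1}"
  by unfold_locales auto

lemma unit_J_eq_integral:
  assumes "continuous_on {0..1} h"
  shows "unit.J h = integral {0..1} h"
proof -
  have "set_integrable lborel {0..1} h"
    using borel_integrable_atLeastAtMost'[OF assms] .
  then show ?thesis
    unfolding unit.J_def
    using set_borel_integral_eq_integral(2)[of "{0..1}" h]
    by (simp add: integral_restrict_space set_lebesgue_integral_def)
qed

section \<open>The zero-one alternative between consecutive roots\<close>

context unit_interval_set begin

text \<open>On test functions \<open>J\<close> vanishes wherever \<open>unit.J\<close> does, so the
  two functionals are proportional. The combination \<open>k\<close> is chosen to have integral
  zero; writing the result as a product avoids dividing by an integral.\<close>

lemma J_test_fun_proportional:
  assumes ann: "\<And>r. J (poly (pderiv (r * B))) = 0"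
    and ab: "0 \<le> a" "b \<le> 1"
    and B: "\<And>x. x \<in> {a<..<b} \<Longrightarrow> poly B x \<noteq> 0"
    and gh: "test_fun a b g" "test_fun a b h"
  shows "J g * unit.J h = J h * unit.J g"
proof -
  have cont: "continuous_on {0..1} g" "continuous_on {0..1} h"
    using gh continuous_on_subset by (auto simp: test_fun_def)
  define k where "k x = g x * unit.J h - h x * unit.J g" for x
  have "unit.J k = 0"
    unfolding k_def unit.J_def by (simp add: unit.integrable_continuous cont)
  moreover have "unit.J k = integral {0..1} k"
    unfolding k_def by (intro unit_J_eq_integral continuous_intros cont)
  moreover have "test_fun a b k" unfolding k_def by (intro test_fun_lincomb gh)
  ultimately have "J k = 0" using J_test_fun_zero[OF ann ab B] by simp
  moreover have "J k = J g * unit.J h - J h * unit.J g"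
    unfolding k_def J_def by (simp add: integrable_continuous cont)
  ultimately show ?thesis by simp
qed

text \<open>Proportionality passes from the plateau functions to the indicators of open sets in the
  limit.\<close>

lemma measure_open_proportional:
  assumes ann: "\<And>r. J (poly (pderiv (r * B))) = 0"
    and ab: "0 \<le> a" "b \<le> 1"
    and B: "\<And>x. x \<in> {a<..<b} \<Longrightarrow> poly B x \<noteq> 0"
    and U: "open U" "U \<subseteq> {a<..<b}" and V: "open V" "V \<subseteq> {a<..<b}"
  shows "measure lborel (K \<inter> U) * measure lborel V = measure lborel (K \<inter> V) * measure lborel U"
proof -
  have "b \<notin> U" "b \<notin> V" using U V by auto
  then have ne: "U \<noteq> UNIV" "V \<noteq> UNIV" by auto
  have sub: "{0..1} \<inter> U = U" "{0..1} \<inter> V = V" using U V ab by force+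
  have "(\<lambda>n. J (plateau U n) * unit.J (plateau V n)) \<longlonglongrightarrow> measure lborel (K \<inter> U) * measure lborel V"
    using J_plateau_tendsto[OF U(1) ne(1)] unit.J_plateau_tendsto[OF V(1) ne(2)] sub
    by (intro tendsto_mult) auto
  moreover have "(\<lambda>n. J (plateau V n) * unit.J (plateau U n)) \<longlonglongrightarrow> measure lborel (K \<inter> V) * measure lborel U"
    using J_plateau_tendsto[OF V(1) ne(2)] unit.J_plateau_tendsto[OF U(1) ne(1)] sub
    by (intro tendsto_mult) auto
  moreover have "J (plateau U n) * unit.J (plateau V n) = J (plateau V n) * unit.J (plateau U n)" for n
    by (rule J_test_fun_proportional[OF ann ab B]) (use U V plateau_test_fun in auto)
  ultimately show ?thesis using LIMSEQ_unique by simp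
qed

text \<open>Suppose \<open>K\<close> has positive measure in the interval. An open neighbourhood of
  this part of \<open>K\<close>, cut to the interval, carries all of that measure, so by
  proportionality it has full length. Outer regularity lets it exceed \<open>K\<close> by as little
  as desired, so \<open>K\<close> has full length too.\<close>

lemma gap_null_or_full:
  assumes ann: "\<And>r. J (poly (pderiv (r * B))) = 0"
    and ab: "0 \<le> a" "a < b" "b \<le> 1"
    and B: "\<And>x. x \<in> {a<..<b} \<Longrightarrow> poly B x \<noteq> 0"
  shows "K \<inter> {a<..<b} \<in> null_sets lborel \<or> {a<..<b} - K \<in> null_sets lborel"
proof (cases "measure lborel (K \<inter> {a<..<b}) = 0")
  case True
  have "K \<inter> {a<..<b} \<in> fmeasurable lborel"
    by (rule fmeasurableI2[of "{a<..<b}"]) (use ab in \<open>auto simp: fmeasurable_def\<close>)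
  then show ?thesis using True by (auto simp: null_sets_def emeasure_eq_measure2)
next
  case False
  let ?I = "{a<..<b}"
  have fI: "?I \<in> fmeasurable lborel" using ab by (auto simp: fmeasurable_def)
  have fK: "K \<inter> ?I \<in> fmeasurable lborel" by (rule fmeasurableI2[OF fI]) auto
  have "b - a \<le> measure lborel (K \<inter> ?I)"
  proof (rule field_le_epsilon)
    fix e :: real assume "e > 0"
    obtain U where U: "open U" "K \<inter> ?I \<subseteq> U" "emeasure lborel (U - K \<inter> ?I) < e"
      using outer_regular_lborel[of "K \<inter> ?I" e] \<open>e > 0\<close> by auto
    have [measurable]: "U \<in> sets borel" using U by simp
    let ?V = "U \<inter> ?I"
    have fV: "?V \<in> fmeasurable lborel" by (rule fmeasurableI2[OF fI]) auto
    have "K \<inter> ?V = K \<inter> ?I" using U by auto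
    then have "measure lborel (K \<inter> ?I) * measure lborel ?I = measure lborel (K \<inter> ?I) * measure lborel ?V"
      using measure_open_proportional[OF ann ab(1,3) B, of ?V ?I] open_Int[OF U(1), of ?I] by auto
    then have "b - a = measure lborel ?V" using False ab by simp
    also have "\<dots> = measure lborel (K \<inter> ?I) + measure lborel (?V - K \<inter> ?I)"
      using U fV fK by (subst measurable_measure_Diff) auto
    also have "measure lborel (?V - K \<inter> ?I) \<le> e"
    proof -
      have "emeasure lborel (?V - K \<inter> ?I) \<le> emeasure lborel (U - K \<inter> ?I)" by (rule emeasure_mono) auto
      then have "emeasure lborel (?V - K \<inter> ?I) \<le> ennreal e" using U by simp
      then show ?thesis using \<open>e > 0\<close> unfolding measure_def by (simp add: enn2real_leI)
    qed
    finally show "b - a \<le> measure lborel (K \<inter> ?I) + e" by simp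
  qed
  moreover have "measure lborel (?I - K \<inter> ?I) = measure lborel ?I - measure lborel (K \<inter> ?I)"
    using fI fK by (intro measurable_measure_Diff) auto
  ultimately have "measure lborel (?I - K) = 0"
    using ab measure_nonneg[of lborel "?I - K"] by (simp add: Diff_Int)
  moreover have "?I - K \<in> fmeasurable lborel" by (rule fmeasurableI2[OF fI]) auto
  ultimately show ?thesis by (auto simp: null_sets_def emeasure_eq_measure2)
qed

lemma ae_finite_union_of_segments:
  assumes ann: "\<And>r. J (poly (pderiv (r * B))) = 0" and "B \<noteq> 0"
  obtains P where "finite P" "\<And>a b. (a, b) \<in> P \<Longrightarrow> 0 \<le> a \<and> a < b \<and> b \<le> 1"
    "sym_diff K (\<Union>(a, b)\<in>P. {a..b}) \<in> null_sets lborel"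
proof -
  \<comment> \<open>With 0 and 1 among the cut points, every other point of the unit interval lies
    in a gap between two consecutive ones. \<open>G\<close> collects these gaps and \<open>P\<close>
    those that \<open>K\<close> fills.\<close>
  define F where "F = {0, 1} \<union> ({x. poly B x = 0} \<inter> {0..1})"
  define G where "G = {(a, b). a \<in> F \<and> b \<in> F \<and> a < b \<and> {a<..<b} \<inter> F = {}}"
  define P where "P = {(a, b). (a, b) \<in> G \<and> {a<..<b} - K \<in> null_sets lborel}"
  have finF: "finite F" using poly_roots_finite[OF \<open>B \<noteq> 0\<close>] by (simp add: F_def)
  have F01: "F \<subseteq> {0..1}" by (auto simp: F_def)
  have finG: "finite G" by (rule finite_subset[of _ "F \<times> F"]) (use finF in \<open>auto simp: G_def\<close>)
  have finP: "finite P" by (rule finite_subset[OF _ finG]) (auto simp: P_def)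
  have null: "K \<inter> {a<..<b} \<in> null_sets lborel" if "(a, b) \<in> G - P" for a b
  proof -
    have "poly B x \<noteq> 0" if "x \<in> {a<..<b}" for x
    proof
      assume "poly B x = 0"
      moreover have "x \<in> {0..1}" using that \<open>(a, b) \<in> G - P\<close> F01 by (force simp: G_def)
      ultimately have "x \<in> F" by (simp add: F_def)
      then show False using that \<open>(a, b) \<in> G - P\<close> by (auto simp: G_def)
    qed
    moreover have "0 \<le> a" "a < b" "b \<le> 1" using that F01 by (auto simp: G_def)
    ultimately show ?thesis using gap_null_or_full[OF ann, of a b] that by (auto simp: P_def)
  qed
  \<comment> \<open>The exceptional points: cut points, points missing from full gaps, and points of
    \<open>K\<close> in null gaps.\<close>
  define N where "N = F \<union> (\<Union>(a, b)\<in>P. {a<..<b} - K) \<union> (\<Union>(a, b)\<in>G - P. K \<inter> {a<..<b})"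
  have N_null: "N \<in> null_sets lborel"
    unfolding N_def
  proof (intro null_sets.Un)
    show "F \<in> null_sets lborel" using finF by (rule finite_imp_null_set_lborel)
    show "(\<Union>(a, b)\<in>P. {a<..<b} - K) \<in> null_sets lborel"
      using finP by (intro null_sets_UN' countable_finite) (auto simp: P_def)
    show "(\<Union>(a, b)\<in>G - P. K \<inter> {a<..<b}) \<in> null_sets lborel"
      using finG null by (intro null_sets_UN' countable_finite) auto
  qed
  have sub_N: "sym_diff K (\<Union>(a, b)\<in>P. {a..b}) \<subseteq> N"
  proof
    fix s assume s: "s \<in> sym_diff K (\<Union>(a, b)\<in>P. {a..b})"
    show "s \<in> N"
    proof (cases "s \<in> F")
      case sF: False
      show ?thesis
      proof (cases "s \<in> K")
        case True
        then have s01: "0 < s" "s < 1" using K_sub sF by (auto simp: F_def less_le)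
        \<comment> \<open>The cut points closest to \<open>s\<close> on either side bound the gap
          containing it.\<close>
        define a where "a = Max {x \<in> F. x < s}"
        define b where "b = Min {x \<in> F. s < x}"
        have fin: "finite {x \<in> F. x < s}" "finite {x \<in> F. s < x}" using finF by auto
        have ne: "{x \<in> F. x < s} \<noteq> {}" "{x \<in> F. s < x} \<noteq> {}" using s01 by (auto simp: F_def)
        have a: "a \<in> F" "a < s" using Max_in[OF fin(1) ne(1)] by (auto simp: a_def)
        have b: "b \<in> F" "s < b" using Min_in[OF fin(2) ne(2)] by (auto simp: b_def)
        have "x \<notin> F" if "a < x" "x < b" for x
        proof
          assume "x \<in> F"
          then have "x < s \<or> s < x" using sF by (metis linorder_neqE)
          then show False
            using Max_ge[OF fin(1), of x] Min_le[OF fin(2), of x] that \<open>x \<in> F\<close> by (auto simp: a_def b_def)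
        qed
        then have "(a, b) \<in> G" using a b by (auto simp: G_def)
        moreover have "(a, b) \<notin> P"
        proof
          assume "(a, b) \<in> P"
          then have "s \<in> (\<Union>(a, b)\<in>P. {a..b})" by (rule UN_I) (use a b in simp)
          then show False using s True by simp
        qed
        ultimately have "(a, b) \<in> G - P" by simp
        then have "s \<in> (\<Union>(a, b)\<in>G - P. K \<inter> {a<..<b})" by (rule UN_I) (use True a b in simp)
        then show ?thesis by (simp only: N_def Un_iff simp_thms)
      next
        case False
        then obtain a b where "(a, b) \<in> P" "a \<le> s" "s \<le> b" using s by auto
        moreover from this have "a \<in> F" "b \<in> F" by (auto simp: P_def G_def)
        ultimately have sab: "s \<in> {a<..<b} - K" using sF False by (auto simp: less_le)
        have "s \<in> (\<Union>(a, b)\<in>P. {a<..<b} - K)"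
          by (rule UN_I[OF \<open>(a, b) \<in> P\<close>]) (use sab in simp)
        then show ?thesis by (simp only: N_def Un_iff simp_thms)
      qed
    qed (simp add: N_def)
  qed
  have "(\<Union>(a, b)\<in>P. {a..b}) \<in> sets lborel"
    using finP by (intro sets.finite_UN) auto
  then have "sym_diff K (\<Union>(a, b)\<in>P. {a..b}) \<in> sets lborel"
    by (intro sets.Un sets.Diff) (simp_all only: sets_lborel K_borel)
  note segs = null_sets_subset[OF N_null this sub_N]
  show ?thesis
  proof (rule that[OF finP _ segs])
    show "0 \<le> a \<and> a < b \<and> b \<le> 1" if "(a, b) \<in> P" for a b
      using that F01 by (auto simp: P_def G_def)
  qed
qed

end

subsection \<open>Projective intervals and rational fractions\<close>

lemma convex_cone_nonneg_quadrant: "convex_cone nonneg_quadrant"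
  by (auto simp: convex_cone_iff nonneg_quadrant_two)

lemma nonneg_quadrant_eq_hull: "nonneg_quadrant = convex_cone hull {vec2 1 0, vec2 0 1}"
proof
  show "convex_cone hull {vec2 1 0, vec2 0 1} \<subseteq> nonneg_quadrant"
    by (rule hull_minimal) (auto simp: nonneg_quadrant_two convex_cone_nonneg_quadrant)
  show "nonneg_quadrant \<subseteq> convex_cone hull {vec2 1 0, vec2 0 1}"
  proof
    fix y assume "y \<in> nonneg_quadrant"
    then have "(y $ 0) *\<^sub>R vec2 1 0 + (y $ 1) *\<^sub>R vec2 0 1 \<in> convex_cone hull {vec2 1 0, vec2 0 1}"
      by (intro convex_cone_hull_add convex_cone_hull_mul) (auto simp: nonneg_quadrant_two hull_inc)
    also have "(y $ 0) *\<^sub>R vec2 1 0 + (y $ 1) *\<^sub>R vec2 0 1 = y"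
      by (simp add: vec_eq_iff all_two)
    finally show "y \<in> convex_cone hull {vec2 1 0, vec2 0 1}" .
  qed
qed

text \<open>The matrix may be singular, so invertibility cannot be invoked. The image is a finitely
  generated convex cone, and such cones are closed.\<close>

lemma closed_image_quadrant: "closed ((*v) (M :: real^2^2) ` nonneg_quadrant)"
proof -
  have "(*v) M ` nonneg_quadrant = convex_cone hull ((*v) M ` {vec2 1 0, vec2 0 1})"
    unfolding nonneg_quadrant_eq_hull by (rule convex_cone_hull_linear_image[symmetric]) simp
  then show ?thesis using closed_convex_cone_hull by (metis finite.emptyI finite_imageI finite_insert)
qed

lemma convex_cone_image_quadrant: "convex_cone ((*v) (M :: real^2^2) ` nonneg_quadrant)"
  by (intro convex_cone_linear_image conjI convex_cone_nonneg_quadrant) simp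

lemma convex_cone_imp_ray_closed: "convex_cone C \<Longrightarrow> ray_closed C"
  by (simp add: convex_cone_iff ray_closed_def)

lemma matrix_vector_mult_two: "((M :: real^2^2) *v z) $ r = M $ r $ 0 * z $ 0 + M $ r $ 1 * z $ 1"
  by (simp add: matrix_vector_mult_def sum_two)

lemma projective_intervalD:
  assumes "projective_interval C"
  shows "closed C" "convex_cone C" "C \<subseteq> nonneg_quadrant"
  using assms closed_image_quadrant convex_cone_image_quadrant
  by (auto simp: projective_interval_def nonneg_quadrant_two matrix_vector_mult_two)

lemma convex_slice:
  assumes "convex C"
  shows "convex (slice C)"
  unfolding convex_alt
proof (intro ballI allI impI)
  fix s t u assume st: "s \<in> slice C" "t \<in> slice C" and u: "0 \<le> u \<and> u \<le> (1::real)"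
  have "(1 - u) *\<^sub>R vec2 s (1 - s) + u *\<^sub>R vec2 t (1 - t) \<in> C"
    using assms st u by (auto simp: slice_def convex_alt)
  also have "(1 - u) *\<^sub>R vec2 s (1 - s) + u *\<^sub>R vec2 t (1 - t) =
      vec2 ((1 - u) *\<^sub>R s + u *\<^sub>R t) (1 - ((1 - u) *\<^sub>R s + u *\<^sub>R t))"
    by (simp add: vec_eq_iff all_two algebra_simps)
  finally show "(1 - u) *\<^sub>R s + u *\<^sub>R t \<in> slice C" by (simp add: slice_def)
qed

text \<open>The columns are the points of the slice line with parameters \<open>a\<close> and
  \<open>b\<close>.\<close>

definition segment_cone :: "real \<Rightarrow> real \<Rightarrow> (real^2) set" where
  "segment_cone a b =
     (*v) (\<chi> r c. if c = 0 then vec2 a (1 - a) $ r else vec2 b (1 - b) $ r) ` nonneg_quadrant"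

lemma projective_interval_segment_cone:
  assumes "0 \<le> a" "a \<le> b" "b \<le> 1"
  shows "projective_interval (segment_cone a b)"
  unfolding projective_interval_def segment_cone_def
  by (intro exI conjI refl) (use assms in \<open>auto simp: all_two\<close>)

lemma slice_segment_cone:
  assumes "a < b"
  shows "slice (segment_cone a b) = {a..b}"
proof (rule set_eqI)
  fix s
  let ?M = "(\<chi> r c. if c = 0 then vec2 a (1 - a) $ r else vec2 b (1 - b) $ r) :: real^2^2"
  have M: "?M *v z = vec2 (a * z $ 0 + b * z $ 1) ((1 - a) * z $ 0 + (1 - b) * z $ 1)" for z
    by (simp add: vec_eq_iff all_two matrix_vector_mult_two)
  show "s \<in> slice (segment_cone a b) \<longleftrightarrow> s \<in> {a..b}"
  proof
    assume "s \<in> slice (segment_cone a b)"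
    then obtain z where "z \<in> nonneg_quadrant" and eqs: "s = a * z $ 0 + b * z $ 1"
        "1 - s = (1 - a) * z $ 0 + (1 - b) * z $ 1"
      unfolding slice_def segment_cone_def mem_Collect_eq M image_iff vec2_eq_iff vec2_nth by blast
    then have z: "0 \<le> z $ 0" "0 \<le> z $ 1" by (simp_all add: nonneg_quadrant_two)
    \<comment> \<open>Both columns have coordinate sum 1, so adding the two equations shows that the
      coordinates of \<open>z\<close> are barycentric.\<close>
    have z1: "z $ 1 = 1 - z $ 0" using eqs by (simp add: algebra_simps)
    have "s - a = (b - a) * z $ 1" "b - s = (b - a) * z $ 0"
      unfolding eqs(1) z1 by (simp_all add: algebra_simps)
    then have "0 \<le> s - a" "0 \<le> b - s" using z assms by auto
    then show "s \<in> {a..b}" by simp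
  next
    assume s: "s \<in> {a..b}"
    define t where "t = (s - a) / (b - a)"
    have t: "0 \<le> t" "t \<le> 1" "s = a + (b - a) * t"
      using s assms by (auto simp: t_def)
    let ?z = "vec2 (1 - t) t"
    have "?M *v ?z = vec2 s (1 - s)"
      unfolding M vec2_nth t(3) by (intro arg_cong2[where f = vec2]) (simp_all add: algebra_simps)
    moreover have "?z \<in> nonneg_quadrant" using t by (simp add: nonneg_quadrant_two)
    ultimately show "s \<in> slice (segment_cone a b)"
      unfolding slice_def segment_cone_def by (metis (mono_tags, lifting) image_eqI mem_Collect_eq)
  qed
qed

section \<open>Rational fractions and integrals over intervals\<close>

lemma rational_fraction_cong:
  "(\<And>x. x \<in> pos_quadrant \<Longrightarrow> f x = g x) \<Longrightarrow> rational_fraction f = rational_fraction g"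
  by (simp add: rational_fraction_def)

lemma real_polynomial_function_nth: "real_polynomial_function (\<lambda>x :: real^2. x $ l)"
  by (intro real_polynomial_function.intros(1) bounded_linear_vec_nth)

lemma rational_fraction_quotient:
  assumes "real_polynomial_function P" "real_polynomial_function Q" "\<And>x. x \<in> pos_quadrant \<Longrightarrow> Q x \<noteq> 0"
  shows "rational_fraction (\<lambda>x. P x / Q x)"
  using assms unfolding rational_fraction_def by blast

lemma rational_fraction_const: "rational_fraction (\<lambda>_. c)"
  using rational_fraction_quotient[of "\<lambda>_. c" "\<lambda>_. 1"] by (simp add: real_polynomial_function.intros(2))

lemma rational_fraction_mult:
  assumes "rational_fraction f" "rational_fraction g"
  shows "rational_fraction (\<lambda>x. f x * g x)"
proof -
  obtain P Q where 1: "real_polynomial_function P" "real_polynomial_function Q"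
    "\<And>x. x \<in> pos_quadrant \<Longrightarrow> Q x \<noteq> 0 \<and> f x = P x / Q x" using assms(1) by (auto simp: rational_fraction_def)
  obtain R T where 2: "real_polynomial_function R" "real_polynomial_function T"
    "\<And>x. x \<in> pos_quadrant \<Longrightarrow> T x \<noteq> 0 \<and> g x = R x / T x" using assms(2) by (auto simp: rational_fraction_def)
  have "rational_fraction (\<lambda>x. (P x * R x) / (Q x * T x))"
    using 1 2 by (intro rational_fraction_quotient real_polynomial_function.intros(4)) auto
  then show ?thesis
    by (rule rational_fraction_cong[THEN iffD1, rotated]) (use 1 2 in auto)
qed

lemma rational_fraction_add:
  assumes "rational_fraction f" "rational_fraction g"
  shows "rational_fraction (\<lambda>x. f x + g x)"
proof -
  obtain P Q where 1: "real_polynomial_function P" "real_polynomial_function Q"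
    "\<And>x. x \<in> pos_quadrant \<Longrightarrow> Q x \<noteq> 0 \<and> f x = P x / Q x" using assms(1) by (auto simp: rational_fraction_def)
  obtain R T where 2: "real_polynomial_function R" "real_polynomial_function T"
    "\<And>x. x \<in> pos_quadrant \<Longrightarrow> T x \<noteq> 0 \<and> g x = R x / T x" using assms(2) by (auto simp: rational_fraction_def)
  have "rational_fraction (\<lambda>x. (P x * T x + R x * Q x) / (Q x * T x))"
    using 1 2 by (intro rational_fraction_quotient real_polynomial_function.intros(4) real_polynomial_function.intros(3)) auto
  then show ?thesis
    by (rule rational_fraction_cong[THEN iffD1, rotated]) (use 1 2 in \<open>auto simp: add_frac_eq\<close>)
qed

lemma rational_fraction_cmult: "rational_fraction f \<Longrightarrow> rational_fraction (\<lambda>x. c * f x)"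
  by (intro rational_fraction_mult rational_fraction_const)

lemma rational_fraction_diff:
  "rational_fraction f \<Longrightarrow> rational_fraction g \<Longrightarrow> rational_fraction (\<lambda>x. f x - g x)"
  using rational_fraction_add[of f "\<lambda>x. (-1) * g x"] rational_fraction_cmult[of g "-1"] by simp

lemma set_integrable_kernel:
  assumes "x \<in> pos_quadrant" "K \<in> sets borel" "K \<subseteq> {0..1}"
  shows "set_integrable lborel K (\<lambda>s. 1 / (x $ 0 * s + x $ 1 * (1 - s))\<^sup>2)"
proof -
  have "continuous_on {0..1} (\<lambda>s. 1 / (x $ 0 * s + x $ 1 * (1 - s))\<^sup>2)"
    using affine_pos[OF assms(1)] by (intro continuous_intros) (auto simp: less_imp_neq[symmetric])
  then show ?thesis
    by (rule set_integrable_subset[OF borel_integrable_atLeastAtMost']) (use assms in auto)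
qed

lemma slice_integral_Icc:
  assumes x: "x \<in> pos_quadrant" and ab: "0 \<le> a" "a \<le> b" "b \<le> 1"
  shows "slice_integral {a..b} x = (b - a) / ((x $ 0 * a + x $ 1 * (1 - a)) * (x $ 0 * b + x $ 1 * (1 - b)))"
proof -
  let ?L = "\<lambda>s. x $ 0 * s + x $ 1 * (1 - s)"
  \<comment> \<open>The usual antiderivative has \<open>x $ 0 - x $ 1\<close> in its denominator.
    This one differs from it by a constant and also covers the case of equal coordinates.\<close>
  let ?F = "\<lambda>s. s / (x $ 1 * ?L s)"
  have pos: "0 < ?L s" if "s \<in> {a..b}" for s using affine_pos[OF x, of s] that ab by auto
  have x1: "x $ 1 > 0" using x by (simp add: pos_quadrant_two)
  have "((\<lambda>s. 1 / (?L s)\<^sup>2) has_integral (?F b - ?F a)) {a..b}"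
  proof (rule fundamental_theorem_of_calculus[OF ab(2)])
    fix s assume "s \<in> {a..b}"
    note L = pos[OF this]
    have "(?F has_real_derivative (1 * (x $ 1 * ?L s) - s * (x $ 1 * (x $ 0 - x $ 1))) / ((x $ 1 * ?L s) * (x $ 1 * ?L s)))
        (at s within {a..b})"
    proof (rule DERIV_divide)
      show "x $ 1 * ?L s \<noteq> 0" using L x1 by simp
    qed (auto intro!: derivative_eq_intros simp: algebra_simps less_imp_neq[symmetric])
    also have "(1 * (x $ 1 * ?L s) - s * (x $ 1 * (x $ 0 - x $ 1))) = x $ 1 * x $ 1"
      by (simp add: algebra_simps)
    also have "x $ 1 * x $ 1 / ((x $ 1 * ?L s) * (x $ 1 * ?L s)) = 1 / (?L s)\<^sup>2"
      using x1 by (simp add: power2_eq_square)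
    finally show "(?F has_vector_derivative 1 / (?L s)\<^sup>2) (at s within {a..b})"
      by (simp add: has_real_derivative_iff_has_vector_derivative)
  qed
  then have "integral {a..b} (\<lambda>s. 1 / (?L s)\<^sup>2) = ?F b - ?F a" by (rule integral_unique)
  moreover have "slice_integral {a..b} x = integral {a..b} (\<lambda>s. 1 / (?L s)\<^sup>2)"
    unfolding slice_integral_def
    by (intro set_borel_integral_eq_integral set_integrable_kernel x) (use ab in auto)
  moreover have "?F b - ?F a = (b - a) / (?L a * ?L b)"
  proof -
    have "?L a \<noteq> 0" "?L b \<noteq> 0" using pos[of a] pos[of b] ab by auto
    then have "?F b - ?F a = (b * ?L a - a * ?L b) / (x $ 1 * (?L a * ?L b))"
      using x1 by (simp add: divide_simps)
    also have "b * ?L a - a * ?L b = x $ 1 * (b - a)" by (simp add: algebra_simps)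
    finally show ?thesis using x1 by simp
  qed
  ultimately show ?thesis by simp
qed

lemma rational_slice_integral_convex:
  assumes "compact C" "convex C" "C \<subseteq> {0..1}"
  shows "rational_fraction (slice_integral C)"
proof -
  have "connected C" using assms(2) by (rule convex_connected)
  then obtain a b where C: "C = {a..b}" using assms(1) connected_compact_interval_1 by blast
  show ?thesis
  proof (cases "a \<le> b")
    case True
    then have ab: "0 \<le> a" "b \<le> 1" using assms(3) C by auto
    have L: "real_polynomial_function (\<lambda>x :: real^2. x $ 0 * c + x $ 1 * (1 - c))" for c
      by (intro real_polynomial_function.intros real_polynomial_function_nth)
    have "rational_fraction (\<lambda>x. (b - a) / ((x $ 0 * a + x $ 1 * (1 - a)) * (x $ 0 * b + x $ 1 * (1 - b))))"
      using affine_pos[of _ a] affine_pos[of _ b] ab True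
      by (intro rational_fraction_quotient real_polynomial_function.intros(4) L real_polynomial_function.intros(2))
         (auto simp: less_imp_neq[symmetric])
    then show ?thesis
      by (rule rational_fraction_cong[THEN iffD1, rotated]) (use slice_integral_Icc ab True C in auto)
  next
    case False
    then have "slice_integral C = (\<lambda>_. 0)"
      using C by (auto simp: slice_integral_def set_lebesgue_integral_def)
    then show ?thesis by (simp add: rational_fraction_const)
  qed
qed

text \<open>The generalisation to \<open>\<Union>I \<inter> C\<close> makes the inclusion-exclusion formula usable in the induction.\<close>

lemma rational_slice_integral_Union:
  assumes "finite I" "\<And>A. A \<in> I \<Longrightarrow> compact A \<and> convex A \<and> A \<subseteq> {0..1::real}"
    and "compact C" "convex C" "C \<subseteq> {0..1}"
  shows "rational_fraction (slice_integral (\<Union>I \<inter> C))"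
  using assms
proof (induction I arbitrary: C rule: finite_induct)
  case empty
  then show ?case using rational_slice_integral_convex[of "{}"] by simp
next
  case (insert A I)
  let ?U = "\<Union>I"
  have A: "compact A" "convex A" "A \<subseteq> {0..1}" using insert.prems by auto
  have AC: "compact (A \<inter> C)" "convex (A \<inter> C)" "A \<inter> C \<subseteq> {0..1}"
    using A insert.prems by (auto intro: compact_Int convex_Int)
  have [measurable]: "?U \<in> sets borel"
    using insert by (intro sets.finite_Union) (auto intro: borel_compact)
  have [measurable]: "A \<in> sets borel" "C \<in> sets borel" using A insert.prems by (auto intro: borel_compact)
  have "slice_integral (\<Union>(insert A I) \<inter> C) x =
      slice_integral (?U \<inter> C) x + slice_integral (A \<inter> C) x - slice_integral (?U \<inter> (A \<inter> C)) x"
    if x: "x \<in> pos_quadrant" for x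
  proof -
    have int: "set_integrable lborel K (\<lambda>s. 1 / (x $ 0 * s + x $ 1 * (1 - s))\<^sup>2)"
      if "K \<in> sets borel" "K \<subseteq> C" for K
      using set_integrable_kernel[OF x that(1)] that(2) insert.prems by blast
    \<comment> \<open>The part of \<open>A \<inter> C\<close> outside \<open>?U\<close> occurs in
      both additivity identities; eliminating it leaves inclusion-exclusion. The induction
      hypothesis is then used for \<open>C\<close> and for \<open>A \<inter> C\<close>.\<close>
    have "slice_integral ((?U \<inter> C) \<union> (A \<inter> C - ?U)) x = slice_integral (?U \<inter> C) x + slice_integral (A \<inter> C - ?U) x"
      unfolding slice_integral_def by (rule set_integral_Un) (auto intro!: int)
    moreover have "slice_integral ((?U \<inter> (A \<inter> C)) \<union> (A \<inter> C - ?U)) x = slice_integral (?U \<inter> (A \<inter> C)) x + slice_integral (A \<inter> C - ?U) x"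
      unfolding slice_integral_def by (rule set_integral_Un) (auto intro!: int)
    moreover have "(?U \<inter> C) \<union> (A \<inter> C - ?U) = \<Union>(insert A I) \<inter> C" "(?U \<inter> (A \<inter> C)) \<union> (A \<inter> C - ?U) = A \<inter> C" by auto
    ultimately show ?thesis by simp
  qed
  moreover have "rational_fraction (\<lambda>x. slice_integral (?U \<inter> C) x + slice_integral (A \<inter> C) x - slice_integral (?U \<inter> (A \<inter> C)) x)"
    using insert AC by (intro rational_fraction_add rational_fraction_diff rational_slice_integral_convex insert.IH) auto
  ultimately show ?case by (rule rational_fraction_cong[THEN iffD2])
qed

section \<open>The equivalence for closed cones\<close>

lemma rational_if_ae_finite_union:
  assumes D: "closed D" "ray_closed D" "D \<subseteq> nonneg_quadrant" and ae: "ae_finite_union_of_intervals D"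
  shows "rational_fraction (\<lambda>x. measure lebesgue {y \<in> D. y \<bullet> x \<le> 1})"
proof -
  obtain I where I: "finite I" "\<And>C. C \<in> I \<Longrightarrow> projective_interval C"
    and null: "sym_diff D (\<Union>I) \<in> null_sets lebesgue"
    using ae by (auto simp: ae_finite_union_of_intervals_def)
  have cl: "closed (\<Union>I)" using I projective_intervalD(1) by (intro closed_Union) auto
  have ray: "ray_closed (\<Union>I)"
    using I projective_intervalD(2) convex_cone_imp_ray_closed by (fastforce simp: ray_closed_def)
  have sub: "\<Union>I \<subseteq> nonneg_quadrant" using I projective_intervalD(3) by blast
  have [measurable]: "D \<in> sets borel" "\<Union>I \<in> sets borel" using D cl by auto
  have meas: "measure lebesgue {y \<in> D. y \<bullet> x \<le> 1} = slice_integral (slice (\<Union>I)) x / 2" if x: "x \<in> pos_quadrant" for x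
  proof -
    have "measure lebesgue {y \<in> D. y \<bullet> x \<le> 1} = measure lebesgue {y \<in> \<Union>I. y \<bullet> x \<le> 1}"
    proof (rule measure_eq_AE)
      show "AE y in lebesgue. y \<in> {y \<in> D. y \<bullet> x \<le> 1} \<longleftrightarrow> y \<in> {y \<in> \<Union>I. y \<bullet> x \<le> 1}"
        using AE_not_in[OF null] by eventually_elim auto
      have "{y \<in> C. y \<bullet> x \<le> 1} \<in> sets borel" if [measurable]: "C \<in> sets borel" for C :: "(real^2) set"
        by measurable
      then show "{y \<in> D. y \<bullet> x \<le> 1} \<in> sets lebesgue" "{y \<in> \<Union>I. y \<bullet> x \<le> 1} \<in> sets lebesgue"
        using D cl by (auto intro!: sets_completionI_sets simp del: Union_iff)
    qed
    also have "\<dots> = slice_integral (slice (\<Union>I)) x / 2"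
      using ray sub x by (intro measure_cone_truncated) auto
    finally show ?thesis .
  qed
  have "rational_fraction (\<lambda>x. (1 / 2) * slice_integral (\<Union>(slice ` I) \<inter> {0..1}) x)"
  proof (intro rational_fraction_cmult rational_slice_integral_Union)
    fix A assume "A \<in> slice ` I"
    then obtain C where C: "C \<in> I" "A = slice C" by auto
    note pI = projective_intervalD[OF I(2)[OF C(1)]]
    have "A \<subseteq> {0..1}" using slice_subset pI(3) C by auto
    moreover have "closed A" using closed_slice pI(1) C by auto
    moreover have "convex A" using convex_slice pI(2) C by (auto simp: convex_cone_def)
    ultimately show "compact A \<and> convex A \<and> A \<subseteq> {0..1}"
      using compact_Icc closed_Int_compact[of A "{0..1}"] by (auto simp: Int_absorb2)
  qed (use I in auto)
  moreover have "\<Union>(slice ` I) \<inter> {0..1} = slice (\<Union>I)"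
    using slice_subset[OF sub] by (auto simp: slice_UN)
  ultimately have "rational_fraction (\<lambda>x. (1 / 2) * slice_integral (slice (\<Union>I)) x)" by simp
  then show ?thesis
    by (rule rational_fraction_cong[THEN iffD2, rotated]) (rule trans[OF meas], simp_all)
qed

lemma ae_finite_union_if_rational:
  assumes D: "closed D" "ray_closed D" "D \<subseteq> nonneg_quadrant"
    and rat: "rational_fraction (\<lambda>x. measure lebesgue {y \<in> D. y \<bullet> x \<le> 1})"
  shows "ae_finite_union_of_intervals D"
proof -
  have Db [measurable]: "D \<in> sets borel" using D by simp
  interpret unit_interval_set "slice D"
    using slice_borel[OF Db] slice_subset[OF D(3)] by unfold_locales
  obtain P Q where PQ: "real_polynomial_function P" "real_polynomial_function Q"
    "\<And>x. x \<in> pos_quadrant \<Longrightarrow> Q x \<noteq> 0 \<and> measure lebesgue {y \<in> D. y \<bullet> x \<le> 1} = P x / Q x"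
    using rat by (auto simp: rational_fraction_def)
  \<comment> \<open>On this line the linear form restricted to the slice becomes
    \<open>1 - w * s\<close>, and polynomials in the plane become polynomials in
    \<open>w\<close>.\<close>
  let ?x = "\<lambda>w :: real. vec2 1 1 + w *\<^sub>R vec2 (-1) 0"
  have x: "?x w = vec2 (1 - w) 1" for w by (simp add: vec_eq_iff all_two)
  have poly_x: "polynomial_function ?x"
    by (intro polynomial_function_add polynomial_function_mult polynomial_function_const polynomial_function_id)
  obtain p where p: "\<And>w. P (?x w) = poly p w"
    using real_polynomial_function_imp_poly[OF real_polynomial_function_compose[OF poly_x PQ(1)]] by (auto simp: o_def)
  obtain q where q: "\<And>w. Q (?x w) = poly q w"
    using real_polynomial_function_imp_poly[OF real_polynomial_function_compose[OF poly_x PQ(2)]] by (auto simp: o_def)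
  have pos: "?x w \<in> pos_quadrant" if "\<bar>w\<bar> < 1" for w
    using that by (simp add: x pos_quadrant_two)
  have eq: "poly q w * J (\<lambda>s. 1 / (1 - w * s)\<^sup>2) = poly (smult 2 p) w" if w: "\<bar>w\<bar> < 1" for w
  proof -
    have "J (\<lambda>s. 1 / (1 - w * s)\<^sup>2) = slice_integral (slice D) (?x w)"
      unfolding J_def slice_integral_def x set_lebesgue_integral_def
      by (subst integral_restrict_space) (auto simp: algebra_simps)
    also have "\<dots> = 2 * measure lebesgue {y \<in> D. y \<bullet> ?x w \<le> 1}"
      using measure_cone_truncated[OF Db D(2,3) pos[OF w]] by simp
    also have "\<dots> = 2 * (poly p w / poly q w)"
      using PQ(3)[OF pos[OF w]] p q by simp
    finally show ?thesis using PQ(3)[OF pos[OF w]] q[of w] by simp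
  qed
  \<comment> \<open>At \<open>w = 0\<close> the line passes through the point (1, 1) of the open
    quadrant, where \<open>Q\<close> is nonzero.\<close>
  have "poly q 0 \<noteq> 0" using PQ(3)[OF pos[of 0]] q[of 0] by simp
  then have "q \<noteq> 0" by auto
  obtain B where "B \<noteq> 0" and B: "\<And>r. J (poly (pderiv (r * B))) = 0"
    using rational_imp_annihilated[OF eq \<open>q \<noteq> 0\<close>] by blast
  obtain S where S: "finite S" "\<And>a b. (a, b) \<in> S \<Longrightarrow> 0 \<le> a \<and> a < b \<and> b \<le> 1"
    and null: "sym_diff (slice D) (\<Union>(a, b)\<in>S. {a..b}) \<in> null_sets lborel"
    using ae_finite_union_of_segments[OF B \<open>B \<noteq> 0\<close>] by blast
  define I where "I = (\<lambda>(a, b). segment_cone a b) ` S"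
  have pI: "projective_interval C" if "C \<in> I" for C
    using that S(2) projective_interval_segment_cone by (fastforce simp: I_def less_imp_le)
  have "finite I" using S by (simp add: I_def)
  then have cl: "closed (\<Union>I)" using pI projective_intervalD(1) by (intro closed_Union) auto
  have "slice (\<Union>I) = (\<Union>(a, b)\<in>S. {a..b})"
    using S(2) slice_segment_cone unfolding slice_UN I_def by force
  then have "slice (sym_diff D (\<Union>I)) \<in> null_sets lborel"
    using null by (simp add: slice_sym_diff)
  moreover have "ray_closed (\<Union>I)"
    using pI projective_intervalD(2) convex_cone_imp_ray_closed by (fastforce simp: ray_closed_def)
  ultimately have "sym_diff D (\<Union>I) \<in> null_sets lborel"
    using D cl pI projective_intervalD(3) by (intro null_cone ray_closed_sym_diff) auto
  then have "sym_diff D (\<Union>I) \<in> null_sets lebesgue" by (rule null_sets_completionI)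
  then show ?thesis
    using \<open>finite I\<close> pI unfolding ae_finite_union_of_intervals_def by blast
qed

section \<open>Application to the domains of the graph\<close>

lemma finite_words: "finite {u \<in> L. length (u :: 2 list) = n}"
  by (rule finite_subset[OF _ finite_lists_length_eq[of "UNIV :: 2 set" n]]) auto

text \<open>Each stage of the intersection is a union over the finitely many words of one
  length.\<close>

lemma closed_wl_domain: "closed (wl_domain E i)"
  unfolding wl_domain_def
  by (intro closed_INT ballI closed_UN finite_words closed_image_quadrant)

lemma ray_closed_wl_domain: "ray_closed (wl_domain E i)"
  unfolding ray_closed_def
proof (intro allI impI)
  fix y and r :: real assume r: "r > 0" and y: "y \<in> wl_domain E i"
  show "r *\<^sub>R y \<in> wl_domain E i"
    unfolding wl_domain_def
  proof
    fix n
    obtain u where u: "u \<in> {u \<in> domain_language E i. length u = n}"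
        "y \<in> (*v) (word_matrix u) ` nonneg_quadrant"
      using y unfolding wl_domain_def by blast
    have "r *\<^sub>R y \<in> (*v) (word_matrix u) ` nonneg_quadrant"
      using u(2) r by (intro convex_cone_scaleR[OF convex_cone_image_quadrant]) auto
    with u(1) show "r *\<^sub>R y \<in> (\<Union>u \<in> {u \<in> domain_language E i. length u = n}.
        (*v) (word_matrix u) ` nonneg_quadrant)"
      by (rule UN_I)
  qed
qed

text \<open>Stage 0 consists of the empty word at most, whose matrix is the identity.\<close>

lemma wl_domain_subset: "wl_domain E i \<subseteq> nonneg_quadrant"
proof
  fix y assume "y \<in> wl_domain E i"
  then have "y \<in> (\<Union>u \<in> {u \<in> domain_language E i. length u = 0}. (*v) (word_matrix u) ` nonneg_quadrant)"
    unfolding wl_domain_def by blast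
  then obtain u where "length u = 0" "y \<in> (*v) (word_matrix u) ` nonneg_quadrant" by blast
  then show "y \<in> nonneg_quadrant" by auto
qed

theorem proposition5p4:
  fixes S :: "'v set" and E :: "('v \<times> 2 \<times> 'v) set"
  assumes "win_lose_graph S E"
    and "\<forall>i \<in> S. \<forall>a. \<exists>!k. (i, a, k) \<in> E"
  shows "(\<forall>i \<in> S. rational_fraction (invariant_density E i)) \<longleftrightarrow>
         (\<forall>i \<in> S. ae_finite_union_of_intervals (wl_domain E i))"
proof -
  \<comment> \<open>The equivalence is obtained for each \<open>i\<close> separately, from the
    domain being closed, closed under positive scaling, and contained in the quadrant.\<close>
  have "rational_fraction (invariant_density E i) \<longleftrightarrow> ae_finite_union_of_intervals (wl_domain E i)" for i
    unfolding invariant_density_def[abs_def]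
    using rational_if_ae_finite_union[OF closed_wl_domain ray_closed_wl_domain wl_domain_subset]
      ae_finite_union_if_rational[OF closed_wl_domain ray_closed_wl_domain wl_domain_subset]
    by (rule iffI[rotated])
  then show ?thesis by simp
qed

end
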